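(* Let $\mathfrak F=\mathfrak F_N(\{a\})$ be the free vertex algebra generated by a single element $a$ with locality bound $N(a,a)=-1$, let $V_{\mathbb Z}$ be the lattice vertex algebra of the lattice $\mathbb Z$ with form $(m|n)=mn$, and let $\varphi:\mathfrak F\to V_{\mathbb Z}$ be the vertex algebra homomorphism with $\varphi(a)=v_1$. For $k\ge1$ let $\mathfrak F_k\subset\mathfrak F$ be the homogeneous component of weight $ka$. Then $\varphi(\mathfrak F_k)=U(W_+)v_k$ for every $k\ge1$.
   Context: All spaces are over a field $\Bbbk$ of characteristic $0$. A vertex algebra is a superspace $A=A_{\bar0}\oplus A_{\bar1}$ with even bilinear products $(a,b)\mapsto a_{(n)}b$, $n\in\mathbb Z$, and a distinguished even element $\mathbf 1$. Put $Da=a_{(-2)}\mathbf 1$, $D^{(k)}=\frac1{k!}D^k$, $Y(a)(z)=\sum_{n\in\mathbb Z}a_{(n)}z^{-n-1}$, where $a_{(n)}$ is viewed as an operator on $A$. Axioms: (V1) $a_{(n)}b=0$ for $n\gg0$; (V2) $\mathbf 1_{(n)}a=\delta_{n,-1}a$, $a_{(n)}\mathbf 1=0$ for $n\ge0$ and $a_{(n)}\mathbf 1=D^{(-n-1)}a$ for $n<0$; (V3) $(Da)_{(n)}b=-n\,a_{(n-1)}b$ and $a_{(n)}(Db)=n\,a_{(n-1)}b+D(a_{(n)}b)$; (V4) locality: for parity-homogeneous $a,b$ there is $M\in\mathbb Z$ such that $Y(a)(w)Y(b)(z)\,\iota_{w,z}(w-z)^M=(-1)^{p(a)p(b)}Y(b)(z)Y(a)(w)\,\iota_{z,w}(w-z)^M$,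 where $p$ is the parity and $\iota_{w,z}$ (resp. $\iota_{z,w}$) means expansion in nonnegative powers of $z$ (resp. of $w$). Homomorphisms preserve $\mathbf 1$ and all products. Free vertex algebra: for a set $\mathcal B$ and a symmetric $N:\mathcal B\times\mathcal B\to\mathbb Z$, $\mathfrak F_N(\mathcal B)$ is the vertex algebra generated by $\mathcal B$, where $a\in\mathcal B$ has parity $N(a,a)\bmod 2$ and $a_{(n)}b=0$ for $a,b\in\mathcal B$, $n\ge N(a,b)$, which is universal with these properties: for any vertex algebra $A$ and any map $\iota:\mathcal B\to A$ with $\iota(a)$ of parity $N(a,a)\bmod 2$ and $\iota(a)_{(n)}\iota(b)=0$ whenever $n\ge N(a,b)$, there is a unique vertex algebra homomorphism $\mathfrak F_N(\mathcal B)\to A$ extending $\iota$. It is graded by weights in $\mathbb Z_+[\mathcal B]$: each $b\in\mathcal B$ has weight $b$, $\mathbf 1$ has weight $0$, and weights add under all products. The vertex algebra $V_{\mathbb Z}$: let $\mathfrak h=\mathbb Z\otimes\Bbbk=\Bbbk$ and let $H=\mathfrak h\otimes\Bbbk[t,t^{-1}]\oplus\Bbbk\mathsf c$, $h(n)=h\otimes t^n$, $[g(m),h(n)]=\delta_{m,-n}\,m\,(g|h)\,\mathsf c$, $\mathsf c$ central. For $j\in\mathbb Z$ let $V_j$ be the Verma $H$-module generated by $v_j$ with $h(n)v_j=0$ for $n>0$, $h(0)v_j=(h|j)v_j$, $\mathsf c=\mathrm{Id}$. Put $V_{\mathbb Z}=\bigoplus_{j\in\mathbb Z}V_j$, with $V_j$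 of parity $j\bmod2$. It has a unique vertex algebra structure with $\mathbf 1=v_0$, $(h(-1)v_0)_{(n)}v=h(n)v$ for $h\in\mathfrak h$, $v\in V_{\mathbb Z}$, and $v_{i\,(n)}v_j=0$ for $n\ge-ij$, $v_{i\,(-ij-k-1)}v_j=\frac1{k!}(D-j(-1))^kv_{i+j}$ for $k\ge0$ (here $j(-1)=j\otimes t^{-1}\in H$). The Lie algebra $W_+$: let $p_m=v_{-1\,(-m-1)}v_1\in V_0$ for $m\in\mathbb Z_+=\{0,1,2,\dots\}$. The elements $p_m$ span over $\Bbbk[D]$, together with $\mathbf 1$, a conformal algebra $\widehat{\mathfrak W}\subset V_0$ (closed under $D$ and the products ${}_{(n)}$, $n\ge0$). $W_+$ is the Lie algebra spanned by the coefficients $p_m(n)$, $m,n\ge0$, and it acts on $V_{\mathbb Z}$ by $p_m(n)x=p_{m\,(n)}x$ (it is isomorphic to the Lie algebra $\Bbbk\langle p,t\mid[t,p]=1\rangle$ of differential operators on the disk, $p_m(n)\leftrightarrow\frac1{m!}p^mt^n$). Thus $U(W_+)v_k$ is the smallest subspace of $V_{\mathbb Z}$ containing $v_k$ and stable under all operators $x\mapsto p_{m\,(n)}x$, $m,n\ge0$. *)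

theory Defs
  imports Complex_Main "HOL-Library.Poly_Mapping" "HOL-Library.Multiset"
begin

section \<open>Finite linear combinations\<close>

definition fscale :: "'k::field_char_0 \<Rightarrow> ('x \<Rightarrow>\<^sub>0 'k) \<Rightarrow> ('x \<Rightarrow>\<^sub>0 'k)" where
  "fscale r = Poly_Mapping.map ((*) r)"

definition lin_ext :: "('k::field_char_0 \<Rightarrow> 'm \<Rightarrow> 'm::ab_group_add) \<Rightarrow> ('x \<Rightarrow> 'm) \<Rightarrow> ('x \<Rightarrow>\<^sub>0 'k) \<Rightarrow> 'm" where
  "lin_ext s g f = (\<Sum>k\<in>Poly_Mapping.keys f. s (Poly_Mapping.lookup f k) (g k))"

lemma lookup_fscale [simp]: "Poly_Mapping.lookup (fscale r f) k = r * Poly_Mapping.lookup f k"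
  by (simp add: fscale_def map.rep_eq when_def)

lemma fscale_vector_space: "vector_space fscale"
  by unfold_locales (auto intro!: poly_mapping_eqI simp: lookup_add algebra_simps)

lemma fscale_single [simp]: "fscale r (Poly_Mapping.single k x) = Poly_Mapping.single k (r * x)"
  by (intro poly_mapping_eqI) (simp add: lookup_single when_def)

lemma fscale_0_right [simp]: "fscale r 0 = 0"
  by (intro poly_mapping_eqI) simp

lemma lin_ext_superset:
  assumes "vector_space s" "finite K" "Poly_Mapping.keys f \<subseteq> K"
  shows "lin_ext s g f = (\<Sum>k\<in>K. s (Poly_Mapping.lookup f k) (g k))"
proof -
  interpret vector_space s by fact
  show ?thesis unfolding lin_ext_def using assms(2,3)
    by (intro sum.mono_neutral_left) (auto simp: in_keys_iff)
qed

lemma lin_ext_linear: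
  assumes "vector_space s"
  shows "Vector_Spaces.linear fscale s (lin_ext s g)"
proof -
  interpret s: vector_space s by fact
  interpret f: vector_space fscale by (rule fscale_vector_space)
  have "lin_ext s g (x + y) = lin_ext s g x + lin_ext s g y" for x y
    using lin_ext_superset[OF assms, of "Poly_Mapping.keys x \<union> Poly_Mapping.keys y" x g]
      lin_ext_superset[OF assms, of "Poly_Mapping.keys x \<union> Poly_Mapping.keys y" y g]
      lin_ext_superset[OF assms, of "Poly_Mapping.keys x \<union> Poly_Mapping.keys y" "x + y" g]
      keys_add[of x y]
    by (simp add: lookup_add s.scale_left_distrib sum.distrib)
  moreover have "lin_ext s g (fscale r x) = s r (lin_ext s g x)" for r x
    using lin_ext_superset[OF assms, of "Poly_Mapping.keys x" "fscale r x" g]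
    by (auto simp: lin_ext_def s.scale_sum_right in_keys_iff subset_iff)
  ultimately show ?thesis by unfold_locales auto
qed

lemma lin_ext_single:
  assumes "vector_space s"
  shows "lin_ext s g (Poly_Mapping.single k r) = s r (g k)"
proof -
  interpret vector_space s by fact
  show ?thesis by (simp add: lin_ext_def)
qed


section \<open>Vertex algebras\<close>

text \<open>
  A vertex algebra is carried by the subspace of the ambient type \<open>'a\<close> that is the sum of its even
  and odd parts; products of elements outside the carrier are irrelevant.  All axioms and all
  homomorphisms are relative to the carrier.
\<close>

record ('k, 'a) valg =
  vscale :: "'k \<Rightarrow> 'a \<Rightarrow> 'a"
  veven :: "'a set"
  vodd :: "'a set"
  vprod :: "'a \<Rightarrow> int \<Rightarrow> 'a \<Rightarrow> 'a"
  vvac :: 'a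

text \<open>The homogeneous part of parity \<open>i mod 2\<close>.\<close>

definition vpart :: "('k, 'a) valg \<Rightarrow> int \<Rightarrow> 'a set" where
  "vpart A i = (if even i then veven A else vodd A)"

definition vcarrier :: "('k, 'a::ab_group_add) valg \<Rightarrow> 'a set" where
  "vcarrier A = {x + y | x y. x \<in> veven A \<and> y \<in> vodd A}"

definition vD :: "('k, 'a) valg \<Rightarrow> 'a \<Rightarrow> 'a" where
  "vD A a = vprod A a (-2) (vvac A)"

text \<open>
  The identity
  \<open>Y(a)(w) Y(b)(z) \<iota>\<^sub>w\<^sub>,\<^sub>z (w - z)\<^sup>M = \<plusminus> Y(b)(z) Y(a)(w) \<iota>\<^sub>z\<^sub>,\<^sub>w (w - z)\<^sup>M\<close>
  applied to \<open>c\<close>, at the coefficient of \<open>w\<^bsup>-p-1\<^esup> z\<^bsup>-q-1\<^esup>\<close>; here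
  \<open>\<iota>\<^sub>w\<^sub>,\<^sub>z (w - z)\<^sup>M\<close> is the sum over \<open>i \<ge> 0\<close> of \<open>(-1)\<^sup>i (M choose i) w\<^bsup>M-i\<^esup> z\<^sup>i\<close>, and
  \<open>\<iota>\<^sub>z\<^sub>,\<^sub>w (w - z)\<^sup>M\<close> that of \<open>(-1)\<^bsup>M-i\<^esup> (M choose i) w\<^sup>i z\<^bsup>M-i\<^esup>\<close>.  Both sums are finite because
  \<open>b\<^bsub>(q+i)\<^esub> c\<close> and \<open>a\<^bsub>(p+i)\<^esub> c\<close> vanish for large \<open>i\<close>.
\<close>

definition local_of_order ::
    "('k::field_char_0, 'a::ab_group_add) valg \<Rightarrow> 'k \<Rightarrow> 'a \<Rightarrow> 'a \<Rightarrow> int \<Rightarrow> bool" where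
  "local_of_order A \<epsilon> a b M \<longleftrightarrow> (\<forall>c\<in>vcarrier A. \<forall>p q.
     Sum_any (\<lambda>i::nat. vscale A ((-1) ^ i * (of_int M gchoose i))
        (vprod A a (p + M - int i) (vprod A b (q + int i) c)))
     = vscale A \<epsilon> (Sum_any (\<lambda>i::nat. vscale A ((-1) powi (M - int i) * (of_int M gchoose i))
        (vprod A b (q + M - int i) (vprod A a (p + int i) c)))))"

definition superspace :: "('k::field_char_0, 'a::ab_group_add) valg \<Rightarrow> bool" where
  "superspace A \<longleftrightarrow> vector_space (vscale A)
     \<and> module.subspace (vscale A) (veven A) \<and> module.subspace (vscale A) (vodd A)
     \<and> veven A \<inter> vodd A = {0}"

definition even_bilinear_products :: "('k::field_char_0, 'a::ab_group_add) valg \<Rightarrow> bool" where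
  "even_bilinear_products A \<longleftrightarrow>
     (\<forall>i j n. \<forall>a\<in>vpart A i. \<forall>b\<in>vpart A j. vprod A a n b \<in> vpart A (i + j))
     \<and> (\<forall>n. \<forall>a\<in>vcarrier A. \<forall>a'\<in>vcarrier A. \<forall>b\<in>vcarrier A.
          vprod A (a + a') n b = vprod A a n b + vprod A a' n b
          \<and> vprod A b n (a + a') = vprod A b n a + vprod A b n a')
     \<and> (\<forall>n r. \<forall>a\<in>vcarrier A. \<forall>b\<in>vcarrier A.
          vprod A (vscale A r a) n b = vscale A r (vprod A a n b)
          \<and> vprod A a n (vscale A r b) = vscale A r (vprod A a n b))"

definition vertex_algebra :: "('k::field_char_0, 'a::ab_group_add) valg \<Rightarrow> bool" where
  "vertex_algebra A \<longleftrightarrow>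
     superspace A \<and> even_bilinear_products A \<and> vvac A \<in> veven A
     \<comment> \<open>V1\<close>
     \<and> (\<forall>a\<in>vcarrier A. \<forall>b\<in>vcarrier A. \<exists>m. \<forall>n\<ge>m. vprod A a n b = 0)
     \<comment> \<open>V2\<close>
     \<and> (\<forall>a\<in>vcarrier A. \<forall>n. vprod A (vvac A) n a = (if n = -1 then a else 0))
     \<and> (\<forall>a\<in>vcarrier A. \<forall>n\<ge>0. vprod A a n (vvac A) = 0)
     \<and> (\<forall>a\<in>vcarrier A. \<forall>k::nat.
          vprod A a (- int k - 1) (vvac A) = vscale A (1 / fact k) ((vD A ^^ k) a))
     \<comment> \<open>V3\<close>
     \<and> (\<forall>a\<in>vcarrier A. \<forall>b\<in>vcarrier A. \<forall>n.
          vprod A (vD A a) n b = vscale A (- of_int n) (vprod A a (n - 1) b)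
          \<and> vprod A a n (vD A b) = vscale A (of_int n) (vprod A a (n - 1) b) + vD A (vprod A a n b))
     \<comment> \<open>V4\<close>
     \<and> (\<forall>i j. \<forall>a\<in>vpart A i. \<forall>b\<in>vpart A j. \<exists>M. local_of_order A ((-1) powi (i * j)) a b M)"

definition va_hom :: "('k::field_char_0, 'a::ab_group_add) valg \<Rightarrow> ('k, 'b::ab_group_add) valg
    \<Rightarrow> ('a \<Rightarrow> 'b) \<Rightarrow> bool" where
  "va_hom A B \<phi> \<longleftrightarrow>
     (\<forall>x\<in>vcarrier A. \<phi> x \<in> vcarrier B)
     \<and> (\<forall>x\<in>vcarrier A. \<forall>y\<in>vcarrier A. \<phi> (x + y) = \<phi> x + \<phi> y)
     \<and> (\<forall>r. \<forall>x\<in>vcarrier A. \<phi> (vscale A r x) = vscale B r (\<phi> x))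
     \<and> \<phi> (vvac A) = vvac B
     \<and> (\<forall>n. \<forall>x\<in>vcarrier A. \<forall>y\<in>vcarrier A. \<phi> (vprod A x n y) = vprod B (\<phi> x) n (\<phi> y))"

definition va_generated_by :: "('k::field_char_0, 'a::ab_group_add) valg \<Rightarrow> 'a set \<Rightarrow> bool" where
  "va_generated_by A S \<longleftrightarrow> S \<subseteq> vcarrier A \<and>
     (\<forall>U. module.subspace (vscale A) U \<and> U \<subseteq> vcarrier A \<and> S \<subseteq> U \<and> vvac A \<in> U
        \<and> (\<forall>x\<in>U. \<forall>y\<in>U. \<forall>n. vprod A x n y \<in> U) \<longrightarrow> U = vcarrier A)"


section \<open>Free vertex algebras\<close>

text \<open>\<open>\<iota>\<close> maps \<open>B\<close> to elements with the prescribed parities and localities.\<close>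

definition admissible :: "'b set \<Rightarrow> ('b \<Rightarrow> 'b \<Rightarrow> int) \<Rightarrow> ('k, 'a::zero) valg \<Rightarrow> ('b \<Rightarrow> 'a) \<Rightarrow> bool" where
  "admissible B N A \<iota> \<longleftrightarrow> (\<forall>b\<in>B. \<iota> b \<in> vpart A (N b b))
     \<and> (\<forall>b\<in>B. \<forall>c\<in>B. \<forall>n\<ge>N b c. vprod A (\<iota> b) n (\<iota> c) = 0)"

definition universal_into :: "'b set \<Rightarrow> ('b \<Rightarrow> 'b \<Rightarrow> int) \<Rightarrow> ('k::field_char_0, 'f::ab_group_add) valg
    \<Rightarrow> ('b \<Rightarrow> 'f) \<Rightarrow> ('k, 'a::ab_group_add) valg \<Rightarrow> bool" where
  "universal_into B N F \<iota> A \<longleftrightarrow> (\<forall>f. admissible B N A f \<longrightarrow>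
     (\<exists>\<phi>. va_hom F A \<phi> \<and> (\<forall>b\<in>B. \<phi> (\<iota> b) = f b)
        \<and> (\<forall>\<psi>. va_hom F A \<psi> \<and> (\<forall>b\<in>B. \<psi> (\<iota> b) = f b) \<longrightarrow> (\<forall>x\<in>vcarrier F. \<psi> x = \<phi> x))))"

datatype 'b vterm = VGen 'b | VVac | VProd "'b vterm" int "'b vterm"

text \<open>
  HOL cannot quantify over all types inside a formula, so the universal property is stated for the
  vertex algebras carried by a subspace of the space of finite linear combinations of formal
  monomials in \<open>B\<close>.  This is no restriction: \<open>free_vertex_algebra_universal\<close> below derives the
  universal property for vertex algebras over every type.
\<close>

definition free_vertex_algebra :: "'b set \<Rightarrow> ('b \<Rightarrow> 'b \<Rightarrow> int)
    \<Rightarrow> ('k::field_char_0, 'f::ab_group_add) valg \<Rightarrow> ('b \<Rightarrow> 'f) \<Rightarrow> bool" where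
  "free_vertex_algebra B N F \<iota> \<longleftrightarrow>
     (\<forall>b\<in>B. \<forall>c\<in>B. N b c = N c b)
     \<and> vertex_algebra F \<and> va_generated_by F (\<iota> ` B) \<and> admissible B N F \<iota>
     \<and> (\<forall>A :: ('k, 'b vterm \<Rightarrow>\<^sub>0 'k) valg. vertex_algebra A \<longrightarrow> universal_into B N F \<iota> A)"

lemma va_unfold:
  assumes "vertex_algebra A"
  shows "vector_space (vscale A)" "module.subspace (vscale A) (veven A)" "module.subspace (vscale A) (vodd A)"
    "veven A \<inter> vodd A = {0}" "vvac A \<in> veven A"
    "\<And>a b i j n. a \<in> vpart A i \<Longrightarrow> b \<in> vpart A j \<Longrightarrow> vprod A a n b \<in> vpart A (i + j)"
    "\<And>a b c n. a \<in> vcarrier A \<Longrightarrow> b \<in> vcarrier A \<Longrightarrow> c \<in> vcarrier A \<Longrightarrow>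
      vprod A (a + b) n c = vprod A a n c + vprod A b n c"
    "\<And>a b c n. a \<in> vcarrier A \<Longrightarrow> b \<in> vcarrier A \<Longrightarrow> c \<in> vcarrier A \<Longrightarrow>
      vprod A c n (a + b) = vprod A c n a + vprod A c n b"
    "\<And>a b r n. a \<in> vcarrier A \<Longrightarrow> b \<in> vcarrier A \<Longrightarrow> vprod A (vscale A r a) n b = vscale A r (vprod A a n b)"
    "\<And>a b r n. a \<in> vcarrier A \<Longrightarrow> b \<in> vcarrier A \<Longrightarrow> vprod A a n (vscale A r b) = vscale A r (vprod A a n b)"
    "\<And>a b. a \<in> vcarrier A \<Longrightarrow> b \<in> vcarrier A \<Longrightarrow> \<exists>m. \<forall>n\<ge>m. vprod A a n b = 0"
proof -
  have S: "superspace A" and E: "even_bilinear_products A" and R: "vvac A \<in> veven A"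
    "\<forall>a\<in>vcarrier A. \<forall>b\<in>vcarrier A. \<exists>m. \<forall>n\<ge>m. vprod A a n b = 0"
    using assms unfolding vertex_algebra_def by simp_all
  show "vector_space (vscale A)" "module.subspace (vscale A) (veven A)" "module.subspace (vscale A) (vodd A)"
    "veven A \<inter> vodd A = {0}" "vvac A \<in> veven A"
    "\<And>a b. a \<in> vcarrier A \<Longrightarrow> b \<in> vcarrier A \<Longrightarrow> \<exists>m. \<forall>n\<ge>m. vprod A a n b = 0"
    using S R unfolding superspace_def by simp_all
  show "\<And>a b i j n. a \<in> vpart A i \<Longrightarrow> b \<in> vpart A j \<Longrightarrow> vprod A a n b \<in> vpart A (i + j)"
    using E unfolding even_bilinear_products_def by blast
  show "\<And>a b c n. a \<in> vcarrier A \<Longrightarrow> b \<in> vcarrier A \<Longrightarrow> c \<in> vcarrier A \<Longrightarrow>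
      vprod A (a + b) n c = vprod A a n c + vprod A b n c"
    "\<And>a b c n. a \<in> vcarrier A \<Longrightarrow> b \<in> vcarrier A \<Longrightarrow> c \<in> vcarrier A \<Longrightarrow>
      vprod A c n (a + b) = vprod A c n a + vprod A c n b"
    "\<And>a b r n. a \<in> vcarrier A \<Longrightarrow> b \<in> vcarrier A \<Longrightarrow> vprod A (vscale A r a) n b = vscale A r (vprod A a n b)"
    "\<And>a b r n. a \<in> vcarrier A \<Longrightarrow> b \<in> vcarrier A \<Longrightarrow> vprod A a n (vscale A r b) = vscale A r (vprod A a n b)"
    using E unfolding even_bilinear_products_def by simp_all
qed

lemma vcarrier_subspace:
  assumes "vertex_algebra A"
  shows "module.subspace (vscale A) (vcarrier A)"
proof -
  note A = va_unfold[OF assms]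
  interpret vector_space "vscale A" by (rule A)
  have "vcarrier A = span (veven A \<union> vodd A)"
    unfolding vcarrier_def span_Un span_eq_iff[THEN iffD2, OF A(2)] span_eq_iff[THEN iffD2, OF A(3)] ..
  then show ?thesis by simp
qed

lemma vpart_subspace: "vertex_algebra A \<Longrightarrow> module.subspace (vscale A) (vpart A i)"
  by (simp add: va_unfold vpart_def)

lemma vpart_carrier:
  assumes "vertex_algebra A" "x \<in> vpart A i"
  shows "x \<in> vcarrier A"
proof -
  note A = va_unfold[OF assms(1)]
  interpret vector_space "vscale A" by (rule A)
  show ?thesis using assms(2) subspace_0[OF A(2)] subspace_0[OF A(3)]
    unfolding vcarrier_def vpart_def by (force split: if_splits)
qed

lemma vcarrierE:
  assumes "x \<in> vcarrier A"
  obtains y z where "y \<in> vpart A 0" "z \<in> vpart A 1" "x = y + z"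
  using assms unfolding vcarrier_def vpart_def by auto

lemma vprod_carrier:
  assumes A: "vertex_algebra A" and x: "x \<in> vcarrier A" and y: "y \<in> vcarrier A"
  shows "vprod A x n y \<in> vcarrier A"
proof -
  interpret vector_space "vscale A" by (rule va_unfold[OF A])
  obtain x0 x1 where x': "x0 \<in> vpart A 0" "x1 \<in> vpart A 1" "x = x0 + x1" using x by (rule vcarrierE)
  obtain y0 y1 where y': "y0 \<in> vpart A 0" "y1 \<in> vpart A 1" "y = y0 + y1" using y by (rule vcarrierE)
  note c = x'(1,2)[THEN vpart_carrier[OF A]] y'(1,2)[THEN vpart_carrier[OF A]]
  have "vprod A x n y = (vprod A x0 n y0 + vprod A x0 n y1) + (vprod A x1 n y0 + vprod A x1 n y1)"
    using x y c by (simp add: x'(3) y'(3) va_unfold[OF A])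
  moreover have "vprod A u n v \<in> vcarrier A" if "u \<in> vpart A i" "v \<in> vpart A j" for u v i j
    using va_unfold(6)[OF A that] vpart_carrier[OF A] by blast
  ultimately show ?thesis
    using x'(1,2) y'(1,2) by (auto intro!: subspace_add[OF vcarrier_subspace[OF A]])
qed

lemma vvac_carrier: "vertex_algebra A \<Longrightarrow> vvac A \<in> vcarrier A"
  by (rule vpart_carrier[where i = 0]) (auto simp: vpart_def va_unfold)

lemma va_sub:
  assumes A: "vertex_algebra A"
    and E: "module.subspace (vscale A) E0" "module.subspace (vscale A) E1" "E0 \<subseteq> veven A" "E1 \<subseteq> vodd A"
      "vvac A \<in> E0"
    and closed: "\<And>a b (i::int) (j::int) n. a \<in> (if even i then E0 else E1) \<Longrightarrow> b \<in> (if even j then E0 else E1) \<Longrightarrow>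
      vprod A a n b \<in> (if even (i + j) then E0 else E1)"
  shows "vertex_algebra (A\<lparr>veven := E0, vodd := E1\<rparr>)"
proof -
  let ?A = "A\<lparr>veven := E0, vodd := E1\<rparr>"
  interpret vector_space "vscale A" by (rule va_unfold[OF A])
  have int: "E0 \<inter> E1 = {0}"
    using E(3,4) va_unfold(4)[OF A] subspace_0[OF E(1)] subspace_0[OF E(2)] by blast
  have c: "vcarrier ?A \<subseteq> vcarrier A" using E(3,4) unfolding vcarrier_def by auto
  have p: "vpart ?A i \<subseteq> vpart A i" for i using E(3,4) by (auto simp: vpart_def)
  have vD: "vD ?A = vD A" by (auto simp: vD_def fun_eq_iff)
  have loc: "local_of_order ?A e a b M" if "local_of_order A e a b M" for e a b M
    using that c unfolding local_of_order_def by auto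
  have part: "vpart ?A i = (if even i then E0 else E1)" for i by (auto simp: vpart_def)
  have super: "superspace ?A" unfolding superspace_def by (simp add: E int vector_space_axioms)
  have prods: "even_bilinear_products ?A"
    unfolding even_bilinear_products_def
  proof (intro conjI allI ballI)
    fix i j n a b assume "a \<in> vpart ?A i" "b \<in> vpart ?A j"
    then show "vprod ?A a n b \<in> vpart ?A (i + j)"
      using closed[of a i b j n] unfolding part by simp
  qed (auto simp: va_unfold(7-10)[OF A] dest!: subsetD[OF c])
  show ?thesis
    unfolding vertex_algebra_def vD
    apply (intro conjI super prods)
    subgoal using E by simp
    subgoal using A c unfolding vertex_algebra_def by (auto simp: subset_iff)
    subgoal using A c unfolding vertex_algebra_def by (auto simp: subset_iff)
    subgoal using A c unfolding vertex_algebra_def by (auto simp: subset_iff)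
    subgoal using A c unfolding vertex_algebra_def by (auto simp: subset_iff)
    subgoal using A c unfolding vertex_algebra_def by (auto simp: subset_iff)
    subgoal using A p loc unfolding vertex_algebra_def by (meson subsetD)
    done
qed

lemma va_transport:
  fixes A :: "('k::field_char_0, 'a::ab_group_add) valg" and s :: "'k \<Rightarrow> 'c::ab_group_add \<Rightarrow> 'c"
  assumes A: "vertex_algebra A" and g: "Vector_Spaces.linear (vscale A) s g" and h: "Vector_Spaces.linear s (vscale A) h"
    and hg: "\<And>x. x \<in> vcarrier A \<Longrightarrow> h (g x) = x"
  defines "B \<equiv> \<lparr>vscale = s, veven = g ` veven A, vodd = g ` vodd A,
      vprod = (\<lambda>x n y. g (vprod A (h x) n (h y))), vvac = g (vvac A)\<rparr>"
  shows "vertex_algebra B" "vcarrier B = g ` vcarrier A" "va_hom B A h" "va_hom A B g"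
proof -
  interpret g: Vector_Spaces.linear "vscale A" s g by fact
  interpret h: Vector_Spaces.linear s "vscale A" h by fact
  note a = va_unfold[OF A]
  note cs = vcarrier_subspace[OF A]
  have e: "x \<in> vcarrier A" if "x \<in> veven A" for x using vpart_carrier[OF A, of x 0] that by (simp add: vpart_def)
  have o: "x \<in> vcarrier A" if "x \<in> vodd A" for x using vpart_carrier[OF A, of x 1] that by (simp add: vpart_def)
  have sel [simp]: "vscale B = s" "veven B = g ` veven A" "vodd B = g ` vodd A" "vvac B = g (vvac A)"
    "vprod B x n y = g (vprod A (h x) n (h y))" for x n y
    by (simp_all add: B_def)
  have part: "vpart B i = g ` vpart A i" for i by (simp add: vpart_def)
  show car: "vcarrier B = g ` vcarrier A"
  proof (intro equalityI subsetI)
    fix x assume "x \<in> vcarrier B"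
    then obtain y z where "y \<in> veven A" "z \<in> vodd A" "x = g (y + z)"
      unfolding vcarrier_def sel g.add by blast
    then show "x \<in> g ` vcarrier A" unfolding vcarrier_def by blast
  next
    fix x assume "x \<in> g ` vcarrier A"
    then obtain y z where "y \<in> veven A" "z \<in> vodd A" "x = g y + g z"
      unfolding vcarrier_def g.add[symmetric] by blast
    then show "x \<in> vcarrier B" unfolding vcarrier_def sel by blast
  qed
  note pc [simp] = vprod_carrier[OF A]
  note [simp] = vvac_carrier[OF A] hg
  have vD: "vD B (g x) = g (vD A x)" if "x \<in> vcarrier A" for x
    using that by (simp add: vD_def)
  have vDc [simp]: "vD A x \<in> vcarrier A" if "x \<in> vcarrier A" for x
    using that by (simp add: vD_def)
  have vDp: "(vD B ^^ k) (g x) = g ((vD A ^^ k) x) \<and> (vD A ^^ k) x \<in> vcarrier A" if "x \<in> vcarrier A" for x k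
    by (induction k) (auto simp: that vD)
  have g0: "g 0 = 0" by (rule g.zero)
  have inj: "g x = g y \<longleftrightarrow> x = y" if "x \<in> vcarrier A" "y \<in> vcarrier A" for x y
  proof
    assume "g x = g y"
    then have "h (g x) = h (g y)" by (rule arg_cong)
    then show "x = y" unfolding hg[OF that(1)] hg[OF that(2)] .
  qed simp
  have super: "superspace B"
    unfolding superspace_def
  proof (intro conjI)
    show "veven B \<inter> vodd B = {0}"
    proof (intro equalityI subsetI)
      fix x assume "x \<in> veven B \<inter> vodd B"
      then obtain y z where yz: "y \<in> veven A" "z \<in> vodd A" "x = g y" "x = g z" by auto
      then have "y = z" using inj[OF e o, of y z] by simp
      then have "y = 0" using yz a(4) by blast
      then show "x \<in> {0}" using yz g0 by simp
    next
      fix x assume "x \<in> {0::'c}"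
      then show "x \<in> veven B \<inter> vodd B"
        using g0 g.vs1.subspace_0[OF a(2)] g.vs1.subspace_0[OF a(3)] by (auto intro!: image_eqI[of _ g 0])
    qed
  qed (auto simp: g.vs2.vector_space_axioms g.subspace_image a)
  have sc [simp]: "vscale A r x \<in> vcarrier A" if "x \<in> vcarrier A" for r x
    using that g.vs1.subspace_scale[OF cs] by blast
  have ad [simp]: "x + y \<in> vcarrier A" if "x \<in> vcarrier A" "y \<in> vcarrier A" for x y
    using that g.vs1.subspace_add[OF cs] by blast
  have prods: "even_bilinear_products B"
    unfolding even_bilinear_products_def part car
  proof (intro conjI allI ballI)
    fix i j n x y assume "x \<in> g ` vpart A i" "y \<in> g ` vpart A j"
    then show "vprod B x n y \<in> g ` vpart A (i + j)"
      using a(6) vpart_carrier[OF A] by auto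
  qed (auto simp: h.add h.scale a g.add g.scale)
  have sum: "Sum_any (\<lambda>i. g (f i)) = g (Sum_any f)" if f: "\<And>i. f i \<in> vcarrier A" for f :: "nat \<Rightarrow> 'a"
  proof -
    have "g (f i) = 0 \<longleftrightarrow> f i = 0" for i using inj[of "f i" 0] f g.vs1.subspace_0[OF cs] g0 by simp
    then show ?thesis unfolding Sum_any.expand_set by (simp add: g.sum)
  qed
  have loc: "local_of_order B r (g x) (g y) M" if "local_of_order A r x y M" and xy: "x \<in> vcarrier A" "y \<in> vcarrier A"
    for r x y M
    unfolding local_of_order_def car
  proof (intro ballI allI)
    fix c p q assume "c \<in> g ` vcarrier A"
    then obtain d where d: "d \<in> vcarrier A" "c = g d" by blast
    show "Sum_any (\<lambda>i::nat. vscale B ((-1) ^ i * (of_int M gchoose i))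
        (vprod B (g x) (p + M - int i) (vprod B (g y) (q + int i) c)))
     = vscale B r (Sum_any (\<lambda>i::nat. vscale B ((-1) powi (M - int i) * (of_int M gchoose i))
        (vprod B (g y) (q + M - int i) (vprod B (g x) (p + int i) c))))"
      using that(1) d xy unfolding local_of_order_def
      by (simp add: g.scale[symmetric] sum)
  qed
  show "vertex_algebra B"
    unfolding vertex_algebra_def
  proof (intro conjI super prods)
    show "vvac B \<in> veven B" using a by simp
    show "\<forall>a\<in>vcarrier B. \<forall>b\<in>vcarrier B. \<exists>m. \<forall>n\<ge>m. vprod B a n b = 0"
      unfolding car
    proof (intro ballI)
      fix x y assume "x \<in> g ` vcarrier A" "y \<in> g ` vcarrier A"
      then obtain x' y' where xy: "x' \<in> vcarrier A" "y' \<in> vcarrier A" "x = g x'" "y = g y'" by blast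
      then obtain m where "\<forall>n\<ge>m. vprod A x' n y' = 0" using a(11) by blast
      then show "\<exists>m. \<forall>n\<ge>m. vprod B x n y = 0" using xy g0 by (intro exI[of _ m]) simp
    qed
    show "\<forall>a\<in>vcarrier B. \<forall>n. vprod B (vvac B) n a = (if n = -1 then a else 0)"
      using A unfolding car vertex_algebra_def by (simp add: g0)
    show "\<forall>a\<in>vcarrier B. \<forall>n\<ge>0. vprod B a n (vvac B) = 0"
      using A unfolding car vertex_algebra_def by (simp add: g0)
    show "\<forall>a\<in>vcarrier B. \<forall>k::nat.
          vprod B a (- int k - 1) (vvac B) = vscale B (1 / fact k) ((vD B ^^ k) a)"
      using A unfolding car vertex_algebra_def by (simp add: vDp g.scale)
    show "\<forall>a\<in>vcarrier B. \<forall>b\<in>vcarrier B. \<forall>n.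
          vprod B (vD B a) n b = vscale B (- of_int n) (vprod B a (n - 1) b)
          \<and> vprod B a n (vD B b) = vscale B (of_int n) (vprod B a (n - 1) b) + vD B (vprod B a n b)"
      using A unfolding car vertex_algebra_def by (simp add: vD g.scale[symmetric] g.add[symmetric])
    show "\<forall>i j. \<forall>a\<in>vpart B i. \<forall>b\<in>vpart B j. \<exists>M. local_of_order B ((-1) powi (i * j)) a b M"
    proof (intro allI ballI)
      fix i j x y assume "x \<in> vpart B i" "y \<in> vpart B j"
      then obtain x' y' where xy: "x' \<in> vpart A i" "y' \<in> vpart A j" "x = g x'" "y = g y'"
        unfolding part by blast
      then obtain M where "local_of_order A ((-1) powi (i * j)) x' y' M"
        using A unfolding vertex_algebra_def by blast
      then show "\<exists>M. local_of_order B ((-1) powi (i * j)) x y M"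
        using loc xy vpart_carrier[OF A] by blast
    qed
  qed
  show "va_hom B A h" unfolding va_hom_def car by (auto simp: h.add h.scale)
  show "va_hom A B g" unfolding va_hom_def car by (auto simp: g.add g.scale)
qed

lemma va_hom_comp:
  assumes "va_hom A B f" "va_hom B C g"
  shows "va_hom A C (g \<circ> f)"
  using assms unfolding va_hom_def by auto

lemma va_hom_unique:
  assumes F: "vertex_algebra F" "va_generated_by F S"
    and h: "va_hom F A \<phi>" "va_hom F A \<psi>" "\<And>x. x \<in> S \<Longrightarrow> \<phi> x = \<psi> x" and x: "x \<in> vcarrier F"
  shows "\<phi> x = \<psi> x"
proof -
  interpret vector_space "vscale F" by (rule va_unfold[OF F(1)])
  note cs = vcarrier_subspace[OF F(1)]
  define U where "U = {x \<in> vcarrier F. \<phi> x = \<psi> x}"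
  have z: "\<phi> 0 = \<psi> 0"
  proof -
    have "\<phi> (0 + 0) = \<phi> 0 + \<phi> 0" "\<psi> (0 + 0) = \<psi> 0 + \<psi> 0"
      using h subspace_0[OF cs] unfolding va_hom_def by blast+
    then show ?thesis by simp
  qed
  have "subspace U"
    unfolding U_def
  proof (rule subspaceI)
    show "0 \<in> {x \<in> vcarrier F. \<phi> x = \<psi> x}" using z subspace_0[OF cs] by simp
    show "x + y \<in> {x \<in> vcarrier F. \<phi> x = \<psi> x}"
      if "x \<in> {x \<in> vcarrier F. \<phi> x = \<psi> x}" "y \<in> {x \<in> vcarrier F. \<phi> x = \<psi> x}" for x y
      using that h subspace_add[OF cs] unfolding va_hom_def by auto
    show "vscale F c x \<in> {x \<in> vcarrier F. \<phi> x = \<psi> x}" if "x \<in> {x \<in> vcarrier F. \<phi> x = \<psi> x}" for c x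
      using that h subspace_scale[OF cs] unfolding va_hom_def by auto
  qed
  moreover have "U \<subseteq> vcarrier F" "S \<subseteq> U" "vvac F \<in> U" "\<forall>x\<in>U. \<forall>y\<in>U. \<forall>n. vprod F x n y \<in> U"
    using h F vvac_carrier[OF F(1)] vprod_carrier[OF F(1)]
    unfolding U_def va_hom_def va_generated_by_def by auto
  ultimately have "U = vcarrier F" using F(2) unfolding va_generated_by_def by blast
  with x show ?thesis by (auto simp: U_def)
qed

context
  fixes B :: "'b set" and N :: "'b \<Rightarrow> 'b \<Rightarrow> int" and A :: "('k::field_char_0, 'a::ab_group_add) valg"
    and f :: "'b \<Rightarrow> 'a"
begin

primrec term_val :: "'b vterm \<Rightarrow> 'a" where
  "term_val (VGen b) = (if b \<in> B then f b else vvac A)"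
| "term_val VVac = vvac A"
| "term_val (VProd s n t) = vprod A (term_val s) n (term_val t)"

primrec term_par :: "'b vterm \<Rightarrow> int" where
  "term_par (VGen b) = (if b \<in> B then N b b else 0)"
| "term_par VVac = 0"
| "term_par (VProd s n t) = term_par s + term_par t"

end

lemma free_vertex_algebra_universal:
  fixes F :: "('k::field_char_0, 'f::ab_group_add) valg" and A :: "('k, 'a::ab_group_add) valg"
    and B :: "'b set"
  assumes F: "free_vertex_algebra B N F \<iota>" and A: "vertex_algebra A"
  shows "universal_into B N F \<iota> A"
  unfolding universal_into_def
proof (intro allI impI)
  fix f assume f: "admissible B N A f"
  define val where "val = term_val B A f"
  define par where "par = term_par B N"
  note a = va_unfold[OF A]
  interpret A: vector_space "vscale A" by (rule a)
  define E where "E i = A.span (val ` {t. even (par t + i)})" for i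
  have par: "val t \<in> vpart A (par t)" for t
    using f by (induction t) (auto simp: val_def par_def admissible_def a vpart_def[of A 0])
  have E_sub: "E i \<subseteq> vpart A i" for i
    unfolding E_def proof (intro A.span_minimal vpart_subspace[OF A] image_subsetI)
    fix t assume "t \<in> {t. even (par t + i)}"
    then have "vpart A (par t) = vpart A i" by (auto simp: vpart_def)
    then show "val t \<in> vpart A i" using par by blast
  qed
  have E_mod: "E i = (if even i then E 0 else E 1)" for i
    unfolding E_def by (auto intro!: arg_cong[where f = A.span] arg_cong[where f = "(`) val"])
  have E_prod: "vprod A x n y \<in> E (i + j)" if x: "x \<in> E i" and y: "y \<in> E j" for x y i j n
  proof -
    have c: "u \<in> vcarrier A" if "u \<in> E i" for u i using that E_sub vpart_carrier[OF A] by blast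
    note cs = vcarrier_subspace[OF A]
    have sub: "A.subspace (E k)" for k by (simp add: E_def)
    have zero: "vprod A u n 0 = 0 \<and> vprod A 0 n u = 0" if u: "u \<in> vcarrier A" for u
      using a(9)[OF u u, of 0 n] a(10)[OF u u, of n 0] by simp
    have R: "A.subspace {y \<in> vcarrier A. vprod A u n y \<in> E k}" if "u \<in> vcarrier A" for u k
      by (rule A.subspaceI)
        (use that zero sub[of k] cs in \<open>auto simp: a A.subspace_0 A.subspace_add A.subspace_scale\<close>)
    have L: "A.subspace {x \<in> vcarrier A. vprod A x n y \<in> E k}" if "y \<in> vcarrier A" for y k
      by (rule A.subspaceI)
        (use that zero sub[of k] cs in \<open>auto simp: a A.subspace_0 A.subspace_add A.subspace_scale\<close>)
    have vc: "val t \<in> vcarrier A" for t using par vpart_carrier[OF A] by blast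
    have terms: "vprod A (val s) n (val t) \<in> E (i + j)" if "even (par s + i)" "even (par t + j)" for s t
    proof -
      have "val (VProd s n t) \<in> E (i + j)"
        unfolding E_def using that by (intro A.span_base imageI) (auto simp: par_def)
      then show ?thesis by (simp add: val_def)
    qed
    have *: "E j \<subseteq> {y \<in> vcarrier A. vprod A (val s) n y \<in> E (i + j)}" if "even (par s + i)" for s
      unfolding E_def[of j] by (rule A.span_minimal[OF _ R[OF vc]]) (use that terms vc in auto)
    have "E i \<subseteq> {x \<in> vcarrier A. vprod A x n y \<in> E (i + j)}"
      unfolding E_def[of i] by (rule A.span_minimal[OF _ L[OF c[OF y]]]) (use * y vc in auto)
    then show ?thesis using x by auto
  qed
  define A1 where "A1 = A\<lparr>veven := E 0, vodd := E 1\<rparr>"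
  have vac: "vvac A \<in> E 0"
    unfolding E_def by (intro A.span_base image_eqI[of _ _ VVac]) (auto simp: val_def par_def)
  have A1: "vertex_algebra A1"
    unfolding A1_def
  proof (rule va_sub[OF A])
    show "vprod A x n y \<in> (if even (i + j) then E 0 else E 1)"
      if "x \<in> (if even i then E 0 else E 1)" "y \<in> (if even j then E 0 else E 1)" for x y n i and j :: int
      using E_prod[of x i y j n] that E_mod by metis
  qed (use E_sub[of 0] E_sub[of 1] vac in \<open>auto simp: vpart_def E_def\<close>)
  have sel [simp]: "vscale A1 = vscale A" "vprod A1 = vprod A" "vvac A1 = vvac A" by (simp_all add: A1_def)
  have part1: "vpart A1 i = E i" for i using E_mod[of i] by (simp add: A1_def vpart_def)
  have car1: "vcarrier A1 \<subseteq> vcarrier A"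
    using E_sub[of 0] E_sub[of 1] unfolding A1_def vcarrier_def by (auto simp: vpart_def)
  define h where "h = lin_ext (vscale A) val"
  have lh: "Vector_Spaces.linear fscale (vscale A) h" unfolding h_def by (rule lin_ext_linear) (rule a)
  interpret h: Vector_Spaces.linear fscale "vscale A" h by (rule lh)
  interpret hp: vector_space_pair fscale "vscale A"
    by (simp add: vector_space_pair_def fscale_vector_space A.vector_space_axioms)
  have E_range: "E i \<subseteq> range h" for i
  proof -
    have "val t = h (Poly_Mapping.single t 1)" for t by (simp add: h_def lin_ext_single a)
    then have "val ` X \<subseteq> range h" for X by auto
    then show ?thesis unfolding E_def by (intro A.span_minimal h.subspace_image) auto
  qed
  obtain g where g: "Vector_Spaces.linear (vscale A) fscale g" and hg: "\<forall>x\<in>range h. h (g x) = x"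
    using hp.linear_exists_right_inverse_on[OF lh h.vs1.subspace_UNIV] by blast
  have "vcarrier A1 \<subseteq> range h"
  proof
    fix x assume "x \<in> vcarrier A1"
    then obtain y z where "y \<in> E 0" "z \<in> E 1" "x = y + z"
      unfolding vcarrier_def A1_def by auto
    then show "x \<in> range h"
      by (simp only:) (rule A.subspace_add[OF h.subspace_image[OF h.vs1.subspace_UNIV] subsetD[OF E_range] subsetD[OF E_range]])
  qed
  then have hg1: "h (g x) = x" if "x \<in> vcarrier A1" for x using that hg by blast
  define A2 where "A2 = \<lparr>vscale = fscale, veven = g ` veven A1, vodd = g ` vodd A1,
      vprod = (\<lambda>x n y. g (vprod A1 (h x) n (h y))), vvac = g (vvac A1)\<rparr>"
  note tr = va_transport[OF A1, of fscale g h, unfolded sel(1), OF g lh hg1, folded A2_def[unfolded sel]]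
  have A2: "vertex_algebra A2" and hom: "va_hom A2 A1 h" using tr by (simp_all add: A2_def)
  have fE: "f b \<in> E (N b b)" if "b \<in> B" for b
    unfolding E_def using that by (intro A.span_base image_eqI[of _ _ "VGen b"]) (auto simp: val_def par_def)
  have fc: "h (g (f b)) = f b" if "b \<in> B" for b
    using fE[OF that] part1 vpart_carrier[OF A1] hg1 by metis
  have "admissible B N A2 (\<lambda>b. g (f b))"
    unfolding admissible_def
  proof (intro conjI ballI allI impI)
    show "g (f b) \<in> vpart A2 (N b b)" if "b \<in> B" for b
      using fE[OF that] part1[of "N b b"] by (auto simp: A2_def vpart_def split: if_splits)
    show "vprod A2 (g (f b)) n (g (f c)) = 0" if "b \<in> B" "c \<in> B" "n \<ge> N b c" for b c n
    proof -
      have "g 0 = 0" using g by (simp add: hp.linear_0 Vector_Spaces.linear_iff_module_hom module_hom.zero)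
      then show ?thesis using that f fc by (simp add: A2_def admissible_def)
    qed
  qed
  then obtain \<phi> where \<phi>: "va_hom F A2 \<phi>" "\<forall>b\<in>B. \<phi> (\<iota> b) = g (f b)"
    using F A2 unfolding free_vertex_algebra_def universal_into_def by meson
  have "va_hom F A1 (h \<circ> \<phi>)" by (rule va_hom_comp[OF \<phi>(1) hom])
  then have 1: "va_hom F A (h \<circ> \<phi>)" using car1 unfolding va_hom_def by auto
  show "\<exists>\<phi>. va_hom F A \<phi> \<and> (\<forall>b\<in>B. \<phi> (\<iota> b) = f b)
        \<and> (\<forall>\<psi>. va_hom F A \<psi> \<and> (\<forall>b\<in>B. \<psi> (\<iota> b) = f b) \<longrightarrow> (\<forall>x\<in>vcarrier F. \<psi> x = \<phi> x))"
  proof (intro exI[of _ "h \<circ> \<phi>"] conjI allI impI ballI)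
    show "va_hom F A (h \<circ> \<phi>)" by (rule 1)
    show 2: "(h \<circ> \<phi>) (\<iota> b) = f b" if "b \<in> B" for b using \<phi> fc that by simp
    fix \<psi> x assume \<psi>: "va_hom F A \<psi> \<and> (\<forall>b\<in>B. \<psi> (\<iota> b) = f b)" and x: "x \<in> vcarrier F"
    have "vertex_algebra F" "va_generated_by F (\<iota> ` B)" using F by (simp_all add: free_vertex_algebra_def)
    then show "\<psi> x = (h \<circ> \<phi>) x"
      by (rule va_hom_unique[OF _ _ conjunct1[OF \<psi>] 1 _ x]) (use \<psi> 2 in auto)
  qed
qed

text \<open>Weights in \<open>\<int>\<^sub>+[B]\<close> are finite multisets of elements of \<open>B\<close>.\<close>

definition weight_grading :: "'b set \<Rightarrow> ('k::field_char_0, 'f::ab_group_add) valg \<Rightarrow> ('b \<Rightarrow> 'f)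
    \<Rightarrow> ('b multiset \<Rightarrow> 'f set) \<Rightarrow> bool" where
  "weight_grading B F \<iota> G \<longleftrightarrow>
     (\<forall>l. set_mset l \<subseteq> B \<longrightarrow> module.subspace (vscale F) (G l))
     \<and> vcarrier F = module.span (vscale F) (\<Union>l\<in>{l. set_mset l \<subseteq> B}. G l)
     \<and> (\<forall>L x. finite L \<and> (\<forall>l\<in>L. set_mset l \<subseteq> B \<and> x l \<in> G l) \<and> (\<Sum>l\<in>L. x l) = 0
          \<longrightarrow> (\<forall>l\<in>L. x l = 0))
     \<and> vvac F \<in> G {#} \<and> (\<forall>b\<in>B. \<iota> b \<in> G {#b#})
     \<and> (\<forall>l l' n. set_mset l \<subseteq> B \<and> set_mset l' \<subseteq> B \<longrightarrow>
          (\<forall>x\<in>G l. \<forall>y\<in>G l'. vprod F x n y \<in> G (l + l')))"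


section \<open>The vertex algebra of the lattice \<open>\<int>\<close>\<close>

text \<open>
  The direct sum of the Verma modules \<open>V\<^sub>j\<close> in its Poincare--Birkhoff--Witt basis: with
  \<open>h(n)\<close> for \<open>h = 1\<close>, the basis vector at \<open>(j, {#i\<^sub>1, \<dots>, i\<^sub>r#})\<close> is
  \<open>h(-i\<^sub>1 - 1) \<cdots> h(-i\<^sub>r - 1) v\<^sub>j\<close>.  That these are the Verma modules is shown in
  \<open>heis_commutator\<close>, \<open>heis_highest\<close> and \<open>Verma_universal\<close> below.
\<close>

type_synonym 'k fock = "(int \<times> nat multiset) \<Rightarrow>\<^sub>0 'k"

fun heis_basis :: "int \<Rightarrow> int \<times> nat multiset \<Rightarrow> 'k::field_char_0 fock" where
  "heis_basis n (j, l) =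
     (if n < 0 then Poly_Mapping.single (j, add_mset (nat (- n - 1)) l) 1
      else if n = 0 then Poly_Mapping.single (j, l) (of_int j)
      else Poly_Mapping.single (j, l - {#nat (n - 1)#}) (of_int n * of_nat (count l (nat (n - 1)))))"

text \<open>\<open>heis h n\<close> is \<open>h(n) = h \<otimes> t\<^sup>n\<close>, for \<open>h\<close> in the one-dimensional space \<open>\<int> \<otimes> k = k\<close>.\<close>

definition heis :: "'k::field_char_0 \<Rightarrow> int \<Rightarrow> 'k fock \<Rightarrow> 'k fock" where
  "heis h n x = fscale h (lin_ext fscale (heis_basis n) x)"

definition vtop :: "int \<Rightarrow> 'k::field_char_0 fock" where
  "vtop j = Poly_Mapping.single (j, {#}) 1"

definition fock_supp :: "int set \<Rightarrow> 'k::field_char_0 fock set" where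
  "fock_supp J = {x. fst ` Poly_Mapping.keys x \<subseteq> J}"

lemma heis_0_right [simp]: "heis h n 0 = 0"
  by (simp add: heis_def lin_ext_def)

lemma heis_linear: "Vector_Spaces.linear fscale fscale (heis h n)"
proof -
  interpret f: vector_space fscale by (rule fscale_vector_space)
  interpret l: Vector_Spaces.linear fscale fscale "lin_ext fscale (heis_basis n)"
    by (rule lin_ext_linear[OF fscale_vector_space])
  show ?thesis
    by unfold_locales (auto simp: heis_def l.add l.scale f.scale_right_distrib mult.commute)
qed

lemma heis_single: "heis h n (Poly_Mapping.single k r) = fscale (h * r) (heis_basis n k)"
proof -
  interpret f: vector_space fscale by (rule fscale_vector_space)
  show ?thesis by (simp add: heis_def lin_ext_single[OF fscale_vector_space])
qed

lemma fock_induct [case_names single add]: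
  fixes x :: "'k::field_char_0 fock"
  assumes "\<And>k r. k \<in> Poly_Mapping.keys x \<Longrightarrow> P (Poly_Mapping.single k r)" "\<And>x y. P x \<Longrightarrow> P y \<Longrightarrow> P (x + y)"
    and "P 0"
  shows "P x"
proof -
  have "P (\<Sum>k\<in>K. Poly_Mapping.single k (Poly_Mapping.lookup x k))"
    if "finite K" "K \<subseteq> Poly_Mapping.keys x" for K
    using that by (induction K rule: finite_induct) (auto intro: assms)
  moreover have "x = (\<Sum>k\<in>Poly_Mapping.keys x. Poly_Mapping.single k (Poly_Mapping.lookup x k))"
    by (intro poly_mapping_eqI) (simp add: lookup_sum lookup_single when_def in_keys_iff)
  ultimately show ?thesis by (metis finite_keys subset_refl)
qed

lemma fock_supp_induct [consumes 1, case_names single add zero]: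
  fixes x :: "'k::field_char_0 fock"
  assumes "x \<in> fock_supp {j}" "\<And>l r. P (Poly_Mapping.single (j, l) r)"
    "\<And>x y. P x \<Longrightarrow> P y \<Longrightarrow> P (x + y)" "P 0"
  shows "P x"
proof (induction x rule: fock_induct)
  case (single k r)
  then have "k = (j, snd k)" using assms(1) by (force simp: fock_supp_def)
  then show ?case by (metis assms(2))
qed (fact assms)+

lemma heis_single_simps:
  "heis h (- int b - 1) (Poly_Mapping.single (j, l) r) = Poly_Mapping.single (j, add_mset b l) (h * r)"
  "heis h 0 (Poly_Mapping.single (j, l) r) = Poly_Mapping.single (j, l) (h * r * of_int j)"
  "heis h (int b + 1) (Poly_Mapping.single (j, l) r) =
     Poly_Mapping.single (j, l - {#b#}) (h * r * ((1 + of_nat b) * of_nat (count l b)))"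
  by (simp_all add: heis_single add.commute)

lemma int_cases_shift:
  obtains "n = 0" | b where "n = int b + 1" | b where "n = - int b - 1"
proof -
  have "n = int (nat (n - 1)) + 1" if "n > 0" using that by simp
  moreover have "n = - int (nat (- n - 1)) - 1" if "n < 0" using that by simp
  ultimately show ?thesis using that by (metis linorder_neqE)
qed

lemma heis_commutator_single:
  "heis g m (heis h n (Poly_Mapping.single (j, l) r)) - heis h n (heis g m (Poly_Mapping.single (j, l) r))
     = (if m = - n then fscale (of_int m * (g * h)) (Poly_Mapping.single (j, l) r) else 0)"
proof -
  let ?e = "Poly_Mapping.single (j, l) r"
  have eq: "heis h (int a + 1) (heis g (- int b - 1) ?e) - heis g (- int b - 1) (heis h (int a + 1) ?e)
     = (if a = b then fscale ((1 + of_nat a) * (g * h)) ?e else 0)" for a b g h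
  proof (cases "a = b")
    case True
    have single_eq: "Poly_Mapping.single (j, l) (x * (c * (1 + n))) - Poly_Mapping.single (j, l) (x * (c * n))
        = Poly_Mapping.single (j, l) (x * c)" for x c n :: 'a
      by (simp add: single_diff[symmetric] algebra_simps del: single_diff)
    from single_eq[of "h * (g * r)" "1 + of_nat b" "of_nat (count l b)"] show ?thesis
      by (cases "b \<in># l") (simp_all add: True heis_single_simps not_in_iff mult_ac)
  next
    case False
    then show ?thesis
      by (cases "a \<in># l") (simp_all add: heis_single_simps not_in_iff diff_union_swap[symmetric] mult_ac)
  qed
  have neg: "A - B = C" if "B - A = - C" for A B C :: "'a fock"
    using that by (metis minus_diff_eq minus_minus)
  show ?thesis
  proof (cases m rule: int_cases_shift)
    case 1
    then show ?thesis
      by (cases n rule: int_cases_shift) (simp_all add: heis_single_simps mult_ac)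
  next
    case (2 a)
    then show ?thesis
    proof (cases n rule: int_cases_shift)
      case 1
      then show ?thesis using 2 by (simp add: heis_single_simps mult_ac)
    next
      case n: (2 b)
      have "a = b \<or> a \<noteq> b" by blast
      then show ?thesis unfolding 2 n by (auto simp: heis_single_simps mult_ac add_mset_commute)
    next
      case n: (3 b)
      have "int a + 1 = - (- int b - 1) \<longleftrightarrow> a = b" "of_int (int a + 1) = (1 + of_nat a :: 'a)" by auto
      then show ?thesis unfolding 2 n by (simp only: eq[where a = a and b = b and g = h and h = g] mult.commute[of h g])
    qed
  next
    case (3 a)
    then show ?thesis
    proof (cases n rule: int_cases_shift)
      case 1
      then show ?thesis using 3 by (simp add: heis_single_simps mult_ac)
    next
      case n: (2 b)
      have minus: "fscale c ?e = - fscale d ?e" if "c = - d" for c d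
        by (simp add: that single_uminus)
      have "heis h (int b + 1) (heis g (- int a - 1) ?e) - heis g (- int a - 1) (heis h (int b + 1) ?e)
        = - (if - int a - 1 = - (int b + 1) then fscale (of_int (- int a - 1) * (g * h)) ?e else 0)"
      proof (cases "a = b")
        case True
        have "(1 + of_nat b) * (g * h) = - (of_int (- int b - 1) * (g * h))"
          by (simp add: algebra_simps)
        from minus[OF this] show ?thesis unfolding eq True by simp
      next
        case False
        then show ?thesis unfolding eq by simp
      qed
      then show ?thesis unfolding 3 n by (rule neg)
    next
      case n: (3 b)
      show ?thesis unfolding 3 n by (simp add: heis_single_simps add_mset_commute mult.left_commute)
    qed
  qed
qed

lemma heis_commutator:
  "heis g m (heis h n x) - heis h n (heis g m x) = (if m = - n then fscale (of_int m * (g * h)) x else 0)"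
proof -
  interpret g: Vector_Spaces.linear fscale fscale "heis g m" by (rule heis_linear)
  interpret h: Vector_Spaces.linear fscale fscale "heis h n" by (rule heis_linear)
  show ?thesis
  proof (induction x rule: fock_induct)
    case (single k r)
    then show ?case by (cases k) (simp only: heis_commutator_single)
  next
    case (add x y)
    have "heis g m (heis h n (x + y)) - heis h n (heis g m (x + y)) =
      (heis g m (heis h n x) - heis h n (heis g m x)) + (heis g m (heis h n y) - heis h n (heis g m y))"
      by (simp add: g.add h.add)
    then show ?case unfolding add by (simp add: g.vs1.scale_right_distrib)
  qed (simp add: g.zero h.zero)
qed

lemma heis_highest:
  "n > 0 \<Longrightarrow> heis h n (vtop j) = 0" "heis h 0 (vtop j) = fscale (h * of_int j) (vtop j)"
  by (auto simp: vtop_def heis_single)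

text \<open>The universal property of the Verma module, over an arbitrary \<open>H\<close>-module with \<open>c\<close> acting by 1.\<close>

lemma Verma_universal:
  fixes s :: "'k::field_char_0 \<Rightarrow> 'm::ab_group_add \<Rightarrow> 'm" and T :: "int \<Rightarrow> 'm \<Rightarrow> 'm"
  assumes s: "vector_space s" and T: "\<And>n. Vector_Spaces.linear s s (T n)"
    and comm: "\<And>m n x. T m (T n x) - T n (T m x) = (if m = - n then s (of_int m) x else 0)"
    and w: "\<And>n. n > 0 \<Longrightarrow> T n w = 0" "T 0 w = s (of_int j) w"
  shows "\<exists>f. Vector_Spaces.linear fscale s f \<and> f (vtop j) = w
      \<and> (\<forall>n. \<forall>x\<in>fock_supp {j}. f (heis 1 n x) = T n (f x))"
    and "\<lbrakk>Vector_Spaces.linear fscale s f; Vector_Spaces.linear fscale s f'; f (vtop j) = w; f' (vtop j) = w;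
      \<And>n x. x \<in> fock_supp {j} \<Longrightarrow> f (heis 1 n x) = T n (f x);
      \<And>n x. x \<in> fock_supp {j} \<Longrightarrow> f' (heis 1 n x) = T n (f' x); x \<in> fock_supp {j}\<rbrakk> \<Longrightarrow> f x = f' x"
proof -
  interpret s: vector_space s by fact
  interpret T: Vector_Spaces.linear s s "T n" for n by (rule T)
  define F where "F = fold_mset (\<lambda>i. T (- int i - 1)) w"
  have swap: "T m (T n x) = T n (T m x) + (if m = - n then s (of_int m) x else 0)" for m n x
    using comm[of m n x] by (simp add: algebra_simps)
  interpret c: comp_fun_commute "\<lambda>i. T (- int i - 1)"
  proof
    fix i i' show "T (- int i' - 1) \<circ> T (- int i - 1) = T (- int i - 1) \<circ> T (- int i' - 1)"
      using swap[of "- int i' - 1" "- int i - 1"] by (simp add: fun_eq_iff)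
  qed
  have F0 [simp]: "F {#} = w" by (simp add: F_def)
  have Fadd: "F (add_mset i l) = T (- int i - 1) (F l)" for i l by (simp add: F_def)
  have T0: "T 0 (F l) = s (of_int j) (F l)" for l
  proof (induction l)
    case (add a l)
    then show ?case using swap[of 0 "- int a - 1" "F l"] by (simp add: Fadd T.scale)
  qed (simp add: w)
  have Tpos: "T (int b + 1) (F l) = s ((1 + of_nat b) * of_nat (count l b)) (F (l - {#b#}))" for b l
  proof (induction l)
    case empty
    show ?case by (simp add: w)
  next
    case (add a l)
    have eq: "T (int b + 1) (F (add_mset a l)) =
      s ((1 + of_nat b) * of_nat (count l b)) (T (- int a - 1) (F (l - {#b#})))
       + (if a = b then s (1 + of_nat b) (F l) else 0)"
      using swap[of "int b + 1" "- int a - 1" "F l"] by (auto simp: Fadd add T.scale)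
    show ?case
    proof (cases "b \<in># l")
      case True
      then obtain l' where l: "l = add_mset b l'" by (metis mset_add)
      show ?thesis
      proof (cases "a = b")
        case True
        have "s (c * n) X + s c X = s (c * (n + 1)) X" for c n X
          by (simp add: s.scale_left_distrib distrib_left)
        from this[of "1 + of_nat b" "of_nat (count l b)" "F l"] show ?thesis
          by (subst eq) (simp add: l True Fadd[symmetric] add.commute)
      qed (subst eq, simp add: l Fadd[symmetric] add_mset_commute)
    next
      case False
      then show ?thesis by (subst eq) (auto simp: not_in_iff)
    qed
  qed
  define f where "f = lin_ext s (\<lambda>(i::int, l). F l)"
  have lf: "Vector_Spaces.linear fscale s f" unfolding f_def by (rule lin_ext_linear[OF s])
  interpret f: Vector_Spaces.linear fscale s f by (rule lf)
  have f1: "f (Poly_Mapping.single (i, l) r) = s r (F l)" for i l r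
    by (simp add: f_def lin_ext_single[OF s])
  have "f (heis 1 n x) = T n (f x)" if "x \<in> fock_supp {j}" for n x
    using that
  proof (induction x rule: fock_supp_induct)
    case (single l r)
    consider "n = 0" | b where "n = int b + 1" | b where "n = - int b - 1"
    proof -
      have "n = int (nat (n - 1)) + 1" if "n > 0" using that by simp
      moreover have "n = - int (nat (- n - 1)) - 1" if "n < 0" using that by simp
      ultimately show ?thesis using that by (metis linorder_neqE)
    qed
    then show ?case
      by cases (simp_all add: heis_single f1 T0 Tpos T.scale Fadd mult_ac)
  next
    case (add x y)
    interpret h: Vector_Spaces.linear fscale fscale "heis 1 n" by (rule heis_linear)
    show ?case by (simp add: h.add f.add T.add add)
  next
    case zero
    interpret h: Vector_Spaces.linear fscale fscale "heis 1 n" by (rule heis_linear)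
    show ?case by (simp add: h.zero f.zero T.zero)
  qed
  then show "\<exists>f. Vector_Spaces.linear fscale s f \<and> f (vtop j) = w
      \<and> (\<forall>n. \<forall>x\<in>fock_supp {j}. f (heis 1 n x) = T n (f x))"
    by (intro exI[of _ f]) (auto simp: lf vtop_def f1)
next
  assume lf: "Vector_Spaces.linear fscale s f" "Vector_Spaces.linear fscale s f'"
    and w: "f (vtop j) = w" "f' (vtop j) = w"
    and h: "\<And>n x. x \<in> fock_supp {j} \<Longrightarrow> f (heis 1 n x) = T n (f x)"
      "\<And>n x. x \<in> fock_supp {j} \<Longrightarrow> f' (heis 1 n x) = T n (f' x)"
    and x: "x \<in> fock_supp {j}"
  interpret f: Vector_Spaces.linear fscale s f by fact
  interpret f': Vector_Spaces.linear fscale s f' by fact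
  have 1: "f (Poly_Mapping.single (j, l) 1) = f' (Poly_Mapping.single (j, l) 1)" for l
  proof (induction l)
    case empty
    show ?case using w by (simp add: vtop_def)
  next
    case (add a l)
    have "Poly_Mapping.single (j, add_mset a l) 1 = heis 1 (- int a - 1) (Poly_Mapping.single (j, l) (1::'k))"
      by (simp add: heis_single)
    moreover have "Poly_Mapping.single (j, l) (1::'k) \<in> fock_supp {j}" by (simp add: fock_supp_def)
    ultimately show ?case using h add by simp
  qed
  have "f (Poly_Mapping.single (j, l) r) = f' (Poly_Mapping.single (j, l) r)" for l r
    using 1[of l] f.scale[of r "Poly_Mapping.single (j, l) 1"] f'.scale[of r "Poly_Mapping.single (j, l) 1"]
    by simp
  then show "f x = f' x"
    by (intro fock_supp_induct[OF x, where P = "\<lambda>x. f x = f' x"]) (auto simp: f.add f'.add f.zero f'.zero)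
qed

definition lattice_VZ :: "('k::field_char_0, 'k fock) valg \<Rightarrow> bool" where
  "lattice_VZ V \<longleftrightarrow> vertex_algebra V
     \<and> vscale V = fscale \<and> veven V = fock_supp {j. even j} \<and> vodd V = fock_supp {j. odd j}
     \<and> vvac V = vtop 0
     \<and> (\<forall>h n x. vprod V (heis h (-1) (vtop 0)) n x = heis h n x)
     \<and> (\<forall>i j n. n \<ge> - i * j \<longrightarrow> vprod V (vtop i) n (vtop j) = 0)
     \<and> (\<forall>i j. \<forall>k::nat. vprod V (vtop i) (- i * j - int k - 1) (vtop j) =
          fscale (1 / fact k) (((\<lambda>x. vD V x - heis (of_int j) (-1) x) ^^ k) (vtop (i + j))))"

text \<open>The homomorphism \<open>F \<rightarrow> V\<^sub>\<int>\<close> exists.\<close>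

lemma lattice_VZ_hom:
  assumes F: "free_vertex_algebra {a} N F \<iota>" and N: "N a a = -1" and V: "lattice_VZ V"
  shows "\<exists>\<phi>. va_hom F V \<phi> \<and> \<phi> (\<iota> a) = vtop 1"
proof -
  have "admissible {a} N V (\<lambda>_. vtop 1)"
    using V N unfolding admissible_def lattice_VZ_def by (auto simp: vpart_def fock_supp_def vtop_def)
  moreover have "universal_into {a} N F \<iota> V"
    using V by (intro free_vertex_algebra_universal[OF F]) (simp add: lattice_VZ_def)
  ultimately show ?thesis unfolding universal_into_def by blast
qed

definition Wp :: "('k::field_char_0, 'k fock) valg \<Rightarrow> nat \<Rightarrow> 'k fock" where
  "Wp V m = vprod V (vtop (-1)) (- int m - 1) (vtop 1)"

text \<open>
  \<open>U(W\<^sub>+) v\<close>: the Lie algebra \<open>W\<^sub>+\<close> is spanned by the \<open>p\<^sub>m(n)\<close>, \<open>m, n \<ge> 0\<close>, acting by \<open>x \<mapsto> p\<^sub>m\<^bsub>(n)\<^esub> x\<close>.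
\<close>

definition UW_submodule :: "('k::field_char_0, 'k fock) valg \<Rightarrow> 'k fock \<Rightarrow> 'k fock set" where
  "UW_submodule V v = \<Inter>{S. module.subspace (vscale V) S \<and> v \<in> S
     \<and> (\<forall>m n::nat. \<forall>x\<in>S. vprod V (Wp V m) (int n) x \<in> S)}"

end

theory Submission
  imports Defs "HOL-Computational_Algebra.Formal_Power_Series"
begin

text \<open>
  The idea is to compare both sides with the span \<open>B\<^sub>k\<close> of the fermionic monomials
  \<open>\<psi>(n\<^sub>1) \<cdots> \<psi>(n\<^sub>k) 1\<close>, where \<open>\<psi>(n)\<close> is the \<open>n\<close>-th mode of \<open>v\<^sub>1\<close>.  Since \<open>\<psi>(m)\<psi>(n) = - \<psi>(n)\<psi>(m)\<close>,
  and \<open>\<psi>(n) 1 = 0\<close> for \<open>n \<ge> 0\<close>, this space is a quotient of the \<open>k\<close>-th exterior power of the space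
  with basis \<open>\<psi>(-1), \<psi>(-2), \<dots>\<close>, and \<open>v\<^sub>k\<close> is the monomial \<open>\<psi>(-k) \<cdots> \<psi>(-1) 1\<close> (\<open>vtop_mon\<close>).

  The equality \<open>\<phi>(F\<^sub>k) = B\<^sub>k\<close> (\<open>image_weight_component\<close>) holds because the elements of \<open>F\<^sub>k\<close> mapped into
  \<open>B\<^sub>k\<close>, taken together for all \<open>k\<close>, span a vertex subalgebra of \<open>F\<close> that contains the generator;
  the point is \<open>B\<^sub>k B\<^sub>l \<subseteq> B\<^sub>k\<^sub>+\<^sub>l\<close> for all products (\<open>mon_span_prod\<close>).

  For \<open>U(W\<^sub>+) v\<^sub>k = B\<^sub>k\<close>, the element \<open>p\<^sub>m(n)\<close> kills the vacuum and satisfies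
  \<open>[p\<^sub>m(n), \<psi>(s)] = (-1)\<^sup>m\<^sup>+\<^sup>1 (m-s-1 choose m) \<psi>(s+n-m)\<close> (\<open>Wp_psi_commutator\<close>), so that it acts on \<open>B\<^sub>k\<close> by
  the Leibniz rule.  For a fixed shift \<open>d = n - m\<close> the functions
  \<open>s \<mapsto> (m-s-1 choose m)\<close> span a space closed under multiplication by linear polynomials, so some
  combination vanishes on all modes of a given monomial but one (\<open>act_stable\<close>).  Hence a single mode
  of a monomial can be moved anywhere else (\<open>mon_move\<close>), and moving one mode after the other leads
  from \<open>v\<^sub>k\<close> to every monomial (\<open>mon_span_subset\<close>).  This is the irreducibility of the exterior
  powers of the irreducible Weyl algebra module \<open>k[t,t\<^sup>-\<^sup>1]/k[t]\<close>, by an explicit density argument.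

  The commutators and associators used above come from the Borcherds identity, which is not among the
  axioms.  It is derived from locality in \<open>borcherds_identity\<close>.
\<close>


section \<open>Binomial sums\<close>

text \<open>
  Commuting a mode past a divided derivative, after a skew-symmetry, produces exactly this sum; it is the
  Vandermonde convolution after negating the upper index of the second factor.
\<close>

lemma gbinomial_Vandermonde_alternating:
  fixes x y :: "'k::field_char_0"
  shows "(\<Sum>i\<le>s. (x gchoose i) * ((-1) ^ (s - i) * (y - of_nat i gchoose (s - i))))
    = (x - y + of_nat s - 1 gchoose s)"
proof -
  have "(-1) ^ (s - i) * (y - of_nat i gchoose (s - i)) = (of_nat s - 1 - y gchoose (s - i))"
    if "i \<le> s" for i
    using that by (subst gbinomial_negated_upper) (simp add: of_nat_diff algebra_simps flip: power_mult_distrib)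
  then have "(\<Sum>i\<le>s. (x gchoose i) * ((-1) ^ (s - i) * (y - of_nat i gchoose (s - i))))
      = (\<Sum>i\<in>{0..s}. (x gchoose i) * (of_nat s - 1 - y gchoose (s - i)))"
    by (intro sum.cong) auto
  also have "\<dots> = (x + (of_nat s - 1 - y) gchoose s)" by (rule gbinomial_Vandermonde)
  finally show ?thesis by (simp add: algebra_simps)
qed

lemma sum_triangle:
  fixes f :: "nat \<Rightarrow> nat \<Rightarrow> 'm::comm_monoid_add"
  assumes "\<And>i k. i + k \<ge> K \<Longrightarrow> f i k = 0"
  shows "(\<Sum>i<K. \<Sum>k<K. f i k) = (\<Sum>s<K. \<Sum>i\<le>s. f i (s - i))"
proof -
  have "(\<Sum>i<K. \<Sum>k<K. f i k) = (\<Sum>(i, k)\<in>{..<K} \<times> {..<K}. f i k)" by (rule sum.cartesian_product)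
  also have "\<dots> = (\<Sum>(i, k)\<in>{(i, k). i + k < K}. f i k)"
    using assms by (intro sum.mono_neutral_right) (auto simp: not_less intro: ccontr)
  finally show ?thesis by (simp add: sum.triangle_reindex)
qed

lemma Sum_any_lessThan:
  fixes f :: "nat \<Rightarrow> 'm::comm_monoid_add"
  assumes "\<And>i. i \<ge> K \<Longrightarrow> f i = 0"
  shows "Sum_any f = (\<Sum>i<K. f i)"
  using assms by (intro Sum_any.expand_superset) (auto simp: not_less[symmetric])

lemma minus_one_powi:
  "(-1) powi (m + n) = ((-1) powi m * (-1) powi n :: 'k::field_char_0)"
  "(-1) powi (m - n) = ((-1) powi m * (-1) powi n :: 'k::field_char_0)"
  "(-1) powi (int i) = ((-1) ^ i :: 'k::field_char_0)"
  "(-1) powi m * (-1) powi m = (1 :: 'k::field_char_0)"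
  "(-1) powi m * ((-1) powi m * x) = (x :: 'k::field_char_0)"
  "(-1) powi 1 = (-1 :: 'k)"
proof -
  have sq: "(-1) powi m * (-1) powi m = (1 :: 'k::field_char_0)" for m
    by (simp add: power_int_minus_left)
  show add: "(-1) powi (m + n) = ((-1) powi m * (-1) powi n :: 'k::field_char_0)" for m n
    by (simp add: power_int_add)
  have "(-1) powi (m - n) * ((-1) powi n * (-1) powi n) = ((-1) powi m * (-1) powi n :: 'k::field_char_0)"
    using add[of "m - n" n] by (simp add: mult.assoc[symmetric])
  then show "(-1) powi (m - n) = ((-1) powi m * (-1) powi n :: 'k::field_char_0)" by (simp add: sq)
  show "(-1) powi m * (-1) powi m = (1 :: 'k::field_char_0)" by (rule sq)
  then show "(-1) powi m * ((-1) powi m * x) = (x :: 'k::field_char_0)" by (simp add: mult.assoc[symmetric])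
qed simp_all


section \<open>Modes and divided derivatives\<close>

text \<open>
  The vertex algebras here exhaust their ambient type, as \<open>V\<^sub>\<int>\<close> does, so that the axioms hold
  without side conditions.
\<close>

locale total_vertex_algebra =
  fixes A :: "('k::field_char_0, 'a::ab_group_add) valg"
  assumes va: "vertex_algebra A" and total: "vcarrier A = UNIV"
begin

sublocale vector_space "vscale A" by (rule va_unfold[OF va])

abbreviation scl (infixr "*s" 75) where "r *s x \<equiv> vscale A r x"

abbreviation nprod ("(_ \<cdot>\<^bsub>_\<^esub>/ _)" [77, 0, 76] 76) where "x \<cdot>\<^bsub>n\<^esub> y \<equiv> vprod A x n y"

definition Ddiv :: "nat \<Rightarrow> 'a \<Rightarrow> 'a" where "Ddiv k x = (1 / fact k) *s (vD A ^^ k) x"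

lemma nprod_add: "(x + y) \<cdot>\<^bsub>n\<^esub> z = x \<cdot>\<^bsub>n\<^esub> z + y \<cdot>\<^bsub>n\<^esub> z" "z \<cdot>\<^bsub>n\<^esub> (x + y) = z \<cdot>\<^bsub>n\<^esub> x + z \<cdot>\<^bsub>n\<^esub> y"
  using va_unfold(7,8)[OF va] by (simp_all add: total)

lemma nprod_scale: "(r *s x) \<cdot>\<^bsub>n\<^esub> z = r *s (x \<cdot>\<^bsub>n\<^esub> z)" "z \<cdot>\<^bsub>n\<^esub> (r *s x) = r *s (z \<cdot>\<^bsub>n\<^esub> x)"
  using va_unfold(9,10)[OF va] by (simp_all add: total)

lemma nprod_zero [simp]: "0 \<cdot>\<^bsub>n\<^esub> z = 0" "z \<cdot>\<^bsub>n\<^esub> 0 = 0"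
  using nprod_scale(1)[of 0 0] nprod_scale(2)[of _ _ 0 0] by simp_all

lemma nprod_minus: "(- x) \<cdot>\<^bsub>n\<^esub> z = - (x \<cdot>\<^bsub>n\<^esub> z)" "z \<cdot>\<^bsub>n\<^esub> (- x) = - (z \<cdot>\<^bsub>n\<^esub> x)"
  using nprod_scale[where r = "-1"] by simp_all

lemma nprod_sum: "z \<cdot>\<^bsub>n\<^esub> (sum f I) = (\<Sum>i\<in>I. z \<cdot>\<^bsub>n\<^esub> (f i))"
  by (induction I rule: infinite_finite_induct) (simp_all add: nprod_add)

lemma nprod_bounded: obtains m where "\<And>n. n \<ge> m \<Longrightarrow> x \<cdot>\<^bsub>n\<^esub> y = 0"
  using va_unfold(11)[OF va] total by (metis UNIV_I)

lemma vac_left: "vvac A \<cdot>\<^bsub>n\<^esub> x = (if n = -1 then x else 0)"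
  and vac_right_nonneg: "n \<ge> 0 \<Longrightarrow> x \<cdot>\<^bsub>n\<^esub> vvac A = 0"
  and vac_right: "x \<cdot>\<^bsub>- int k - 1\<^esub> vvac A = Ddiv k x"
  and D_left: "vD A x \<cdot>\<^bsub>n\<^esub> y = - of_int n *s x \<cdot>\<^bsub>n - 1\<^esub> y"
  and D_right: "x \<cdot>\<^bsub>n\<^esub> vD A y = of_int n *s x \<cdot>\<^bsub>n - 1\<^esub> y + vD A (x \<cdot>\<^bsub>n\<^esub> y)"
  using va unfolding vertex_algebra_def total Ddiv_def by simp_all

lemma locality:
  assumes "x \<in> vpart A i" "y \<in> vpart A j"
  obtains M where "local_of_order A ((-1) powi (i * j)) x y M"
  using assms va unfolding vertex_algebra_def by blast

lemma D_linear: "vD A (x + y) = vD A x + vD A y" "vD A (r *s x) = r *s vD A x" "vD A 0 = 0"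
  "vD A (sum f I) = (\<Sum>i\<in>I. vD A (f i))"
proof -
  show add: "vD A (x + y) = vD A x + vD A y" for x y by (simp add: vD_def nprod_add)
  show "vD A (r *s x) = r *s vD A x" by (simp add: vD_def nprod_scale)
  show z: "vD A 0 = 0" by (simp add: vD_def)
  show "vD A (sum f I) = (\<Sum>i\<in>I. vD A (f i))"
    by (induction I rule: infinite_finite_induct) (simp_all add: add z)
qed

lemma Ddiv_0 [simp]: "Ddiv 0 x = x" by (simp add: Ddiv_def)

lemma D_Ddiv: "vD A (Ddiv k x) = of_nat (Suc k) *s Ddiv (Suc k) x"
proof -
  have "of_nat (Suc k) * (1 / fact (Suc k)) = (1 / fact k :: 'k)"
    by (simp only: fact_Suc of_nat_mult[symmetric]) (simp del: of_nat_Suc)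
  then show ?thesis by (simp only: Ddiv_def D_linear scale_scale funpow.simps o_apply)
qed

lemma Ddiv_Suc: "Ddiv (Suc k) x = (1 / of_nat (Suc k)) *s vD A (Ddiv k x)"
  unfolding D_Ddiv by (simp del: of_nat_Suc)

lemma Ddiv_linear: "Ddiv k (x + y) = Ddiv k x + Ddiv k y" "Ddiv k (r *s x) = r *s Ddiv k x"
  "Ddiv k 0 = 0" "Ddiv k (sum f I) = (\<Sum>i\<in>I. Ddiv k (f i))"
proof -
  show add: "Ddiv k (x + y) = Ddiv k x + Ddiv k y" for x y
    by (induction k) (simp_all add: Ddiv_Suc D_linear scale_right_distrib)
  show "Ddiv k (r *s x) = r *s Ddiv k x"
    by (induction k) (simp_all add: Ddiv_Suc D_linear mult.commute)
  show z: "Ddiv k 0 = 0" by (induction k) (simp_all add: Ddiv_Suc D_linear)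
  show "Ddiv k (sum f I) = (\<Sum>i\<in>I. Ddiv k (f i))"
    by (induction I rule: infinite_finite_induct) (simp_all add: add z)
qed

text \<open>The effect of \<open>e\<^sup>z\<^sup>D\<close> on modes, coefficient by coefficient.\<close>

lemma Ddiv_left: "Ddiv k x \<cdot>\<^bsub>n\<^esub> y = ((-1) ^ k * (of_int n gchoose k)) *s x \<cdot>\<^bsub>n - int k\<^esub> y"
proof (induction k arbitrary: n)
  case (Suc k)
  have "of_nat (Suc k) * (of_int n gchoose Suc k) = of_int n * ((of_int n - 1 :: 'k) gchoose k)"
    by (rule gbinomial_absorption)
  then have "(of_int n gchoose Suc k) = of_int n * ((of_int n - 1 :: 'k) gchoose k) / of_nat (Suc k)"
    by (simp add: field_simps del: of_nat_Suc)
  moreover have n: "n - int (Suc k) = n - 1 - int k" by simp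
  ultimately show ?case unfolding n by (simp add: Ddiv_Suc nprod_scale D_left Suc mult_ac del: of_nat_Suc)
qed simp

lemma Ddiv_right: "x \<cdot>\<^bsub>n\<^esub> Ddiv j y = (\<Sum>k\<le>j. (of_int n gchoose k) *s Ddiv (j - k) (x \<cdot>\<^bsub>n - int k\<^esub> y))"
proof (induction j arbitrary: n)
  case (Suc j)
  define t where "t k = Ddiv (Suc j - k) (x \<cdot>\<^bsub>n - int k\<^esub> y)" for k
  have absorb: "of_int n * ((of_int (n - 1) :: 'k) gchoose k) = of_nat (Suc k) * (of_int n gchoose Suc k)" for k
    using gbinomial_absorption[of k "of_int n :: 'k"] by simp
  have "of_nat (Suc j) *s x \<cdot>\<^bsub>n\<^esub> Ddiv (Suc j) y = x \<cdot>\<^bsub>n\<^esub> vD A (Ddiv j y)"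
    by (simp only: D_Ddiv nprod_scale)
  also have "\<dots> = (\<Sum>k\<le>j. (of_nat (Suc k) * (of_int n gchoose Suc k)) *s t (Suc k))
       + (\<Sum>k\<le>j. (of_int n gchoose k) *s vD A (Ddiv (j - k) (x \<cdot>\<^bsub>n - int k\<^esub> y)))"
    unfolding D_right Suc scale_sum_right D_linear scale_scale absorb t_def
    by (simp add: algebra_simps)
  also have "(\<Sum>k\<le>j. (of_nat (Suc k) * (of_int n gchoose Suc k)) *s t (Suc k))
      = (\<Sum>k\<le>Suc j. (of_nat k * (of_int n gchoose k)) *s t k)"
    by (subst sum.atMost_Suc_shift) simp
  also have "(\<Sum>k\<le>j. (of_int n gchoose k) *s vD A (Ddiv (j - k) (x \<cdot>\<^bsub>n - int k\<^esub> y)))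
      = (\<Sum>k\<le>Suc j. (of_nat (Suc j - k) * (of_int n gchoose k)) *s t k)"
    by (simp add: D_Ddiv t_def Suc_diff_le mult.commute del: of_nat_Suc of_nat_diff)
  also have "(\<Sum>k\<le>Suc j. (of_nat k * (of_int n gchoose k)) *s t k)
      + (\<Sum>k\<le>Suc j. (of_nat (Suc j - k) * (of_int n gchoose k)) *s t k)
    = of_nat (Suc j) *s (\<Sum>k\<le>Suc j. (of_int n gchoose k) *s t k)"
    unfolding scale_sum_right sum.distrib[symmetric] scale_left_distrib[symmetric] scale_scale
      distrib_right[symmetric] of_nat_add[symmetric]
    by (intro sum.cong) auto
  finally show ?case by (simp add: t_def del: of_nat_Suc)
qed simp


section \<open>The two sides of the Borcherds identity\<close>

text \<open>
  All sums in the Borcherds identity are binomial series \<open>\<Sum>\<^sub>i (x choose i) g\<^sub>i\<close> with \<open>g\<^sub>i = 0\<close> for large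
  \<open>i\<close>, which gives Pascal's rule \<open>bsum_Suc\<close> as a common source of all recursions.
\<close>

definition bsum :: "int \<Rightarrow> (nat \<Rightarrow> 'a) \<Rightarrow> 'a" where
  "bsum x g = Sum_any (\<lambda>i. (of_int x gchoose i) *s g i)"

lemma bsum_lessThan: "(\<And>i. i \<ge> K \<Longrightarrow> g i = 0) \<Longrightarrow> bsum x g = (\<Sum>i<K. (of_int x gchoose i) *s g i)"
  unfolding bsum_def by (rule Sum_any_lessThan) simp

lemma bsum_0: "bsum 0 g = g 0"
proof -
  have "bsum 0 g = (\<Sum>i<1. (of_int 0 gchoose i) *s g i)"
    unfolding bsum_def by (intro Sum_any_lessThan) (simp add: gbinomial_0_left)
  then show ?thesis by simp
qed

lemma bsum_Suc:
  assumes "\<exists>K. \<forall>i\<ge>K. g i = 0"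
  shows "bsum (x + 1) g = bsum x g + bsum x (\<lambda>i. g (Suc i))"
proof -
  obtain K where K: "\<And>i. i \<ge> K \<Longrightarrow> g i = 0" using assms by blast
  have "bsum (x + 1) g = (\<Sum>i<Suc K. (of_int (x + 1) gchoose i) *s g i)"
    using K by (intro bsum_lessThan) simp
  also have "\<dots> = (\<Sum>i<Suc K. (of_int x gchoose i) *s g i) + (\<Sum>i<K. (of_int x gchoose i) *s g (Suc i))"
    unfolding sum.lessThan_Suc_shift of_int_add of_int_1 gbinomial_Suc_Suc scale_left_distrib sum.distrib
    by (simp add: add_ac)
  also have "(\<Sum>i<Suc K. (of_int x gchoose i) *s g i) = bsum x g"
    using K by (intro bsum_lessThan[symmetric]) simp
  also have "(\<Sum>i<K. (of_int x gchoose i) *s g (Suc i)) = bsum x (\<lambda>i. g (Suc i))"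
    using K by (intro bsum_lessThan[symmetric]) simp
  finally show ?thesis .
qed

lemma bsum_mem:
  assumes "subspace S" "\<And>i. g i \<in> S"
  shows "bsum x g \<in> S"
  unfolding bsum_def Sum_any.expand_set using assms by (intro subspace_sum subspace_scale)

lemma bsum_eq_single: "(\<And>i. i > 0 \<Longrightarrow> g i = 0) \<Longrightarrow> bsum x g = g 0"
  by (subst bsum_lessThan[of 1]) auto

lemma bsum_minus: "bsum x (\<lambda>i. - g i) = - bsum x g"
proof -
  have "Sum_any (\<lambda>i. - h i) = - Sum_any h" for h :: "nat \<Rightarrow> 'a"
    unfolding Sum_any.expand_set by (simp add: sum_negf)
  then show ?thesis by (simp add: bsum_def)
qed

lemma nprod_tail: "\<exists>K. \<forall>i\<ge>K. f i \<cdot>\<^bsub>n - int i\<^esub> (y \<cdot>\<^bsub>q + int i\<^esub> z) = 0"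
  "\<exists>K. \<forall>i\<ge>K. (x \<cdot>\<^bsub>q + int i\<^esub> y) \<cdot>\<^bsub>n - int i\<^esub> z = 0"
proof -
  have *: "\<exists>K. \<forall>i\<ge>K. u \<cdot>\<^bsub>q + int i\<^esub> v = 0" for u v
  proof -
    obtain m where m: "\<And>n. n \<ge> m \<Longrightarrow> u \<cdot>\<^bsub>n\<^esub> v = 0" using nprod_bounded[of u v] by blast
    have "\<forall>i\<ge>nat (m - q). u \<cdot>\<^bsub>q + int i\<^esub> v = 0" by (auto intro!: m)
    then show ?thesis by blast
  qed
  from *[of y z] show "\<exists>K. \<forall>i\<ge>K. f i \<cdot>\<^bsub>n - int i\<^esub> (y \<cdot>\<^bsub>q + int i\<^esub> z) = 0" by (metis nprod_zero(2))
  from *[of x y] show "\<exists>K. \<forall>i\<ge>K. (x \<cdot>\<^bsub>q + int i\<^esub> y) \<cdot>\<^bsub>n - int i\<^esub> z = 0" by (metis nprod_zero(1))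
qed

text \<open>
  With \<open>\<epsilon> = (-1)\<^bsup>p(x)p(y)\<^esup>\<close> the Borcherds identity reads
  \<open>nested_prod x y z p q r = ord_prod x y z p q r - \<epsilon> (-1)\<^sup>r ord_prod y x z q p r\<close>; \<open>borcherds_defect\<close> is
  the difference of the two sides.  It is the coefficient at \<open>(p, q, r)\<close> of the Jacobi identity for
  formal fields, and multiplication by \<open>w - z\<close> becomes the recursion \<open>borcherds_defect_Suc\<close>.
\<close>

definition ord_prod :: "'a \<Rightarrow> 'a \<Rightarrow> 'a \<Rightarrow> int \<Rightarrow> int \<Rightarrow> int \<Rightarrow> 'a" where
  "ord_prod x y z p q r = bsum r (\<lambda>i. (-1) ^ i *s x \<cdot>\<^bsub>p + r - int i\<^esub> y \<cdot>\<^bsub>q + int i\<^esub> z)"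

definition nested_prod :: "'a \<Rightarrow> 'a \<Rightarrow> 'a \<Rightarrow> int \<Rightarrow> int \<Rightarrow> int \<Rightarrow> 'a" where
  "nested_prod x y z p q r = bsum p (\<lambda>i. (x \<cdot>\<^bsub>r + int i\<^esub> y) \<cdot>\<^bsub>p + q - int i\<^esub> z)"

definition borcherds_defect :: "'k \<Rightarrow> 'a \<Rightarrow> 'a \<Rightarrow> 'a \<Rightarrow> int \<Rightarrow> int \<Rightarrow> int \<Rightarrow> 'a" where
  "borcherds_defect \<epsilon> x y z p q r = nested_prod x y z p q r
     - (ord_prod x y z p q r - (\<epsilon> * (-1) powi r) *s ord_prod y x z q p r)"

lemma ord_prod_tail: "\<exists>K. \<forall>i\<ge>K. (-1) ^ i *s x \<cdot>\<^bsub>p - int i\<^esub> y \<cdot>\<^bsub>q + int i\<^esub> z = 0"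
  using nprod_tail(1)[of "\<lambda>_. x" p y q z] by (metis scale_zero_right)

lemma ord_prod_Suc: "ord_prod x y z p q (r + 1) = ord_prod x y z (p + 1) q r - ord_prod x y z p (q + 1) r"
proof -
  let ?g = "\<lambda>i. (-1) ^ i *s x \<cdot>\<^bsub>p + (r + 1) - int i\<^esub> y \<cdot>\<^bsub>q + int i\<^esub> z"
  have "bsum (r + 1) ?g = bsum r ?g + bsum r (\<lambda>i. ?g (Suc i))"
    by (rule bsum_Suc[OF ord_prod_tail])
  also have "(\<lambda>i. ?g (Suc i)) = (\<lambda>i. - ((-1) ^ i *s x \<cdot>\<^bsub>p + r - int i\<^esub> y \<cdot>\<^bsub>q + 1 + int i\<^esub> z))"
    by (intro ext) (simp add: add_ac scale_minus_left[symmetric] del: scale_minus_left)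
  finally show ?thesis unfolding bsum_minus ord_prod_def by (simp add: algebra_simps)
qed

lemma nested_prod_Suc:
  "nested_prod x y z p q (r + 1) = nested_prod x y z (p + 1) q r - nested_prod x y z p (q + 1) r"
proof -
  let ?g = "\<lambda>i. (x \<cdot>\<^bsub>r + int i\<^esub> y) \<cdot>\<^bsub>p + 1 + q - int i\<^esub> z"
  have "bsum (p + 1) ?g = bsum p ?g + bsum p (\<lambda>i. ?g (Suc i))"
    by (rule bsum_Suc[OF nprod_tail(2)])
  also have "(\<lambda>i. ?g (Suc i)) = (\<lambda>i. (x \<cdot>\<^bsub>r + 1 + int i\<^esub> y) \<cdot>\<^bsub>p + q - int i\<^esub> z)"
    by (intro ext) (simp add: algebra_simps)
  finally show ?thesis unfolding nested_prod_def by (simp add: algebra_simps)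
qed

lemma borcherds_defect_Suc:
  "borcherds_defect \<epsilon> x y z p q (r + 1) = borcherds_defect \<epsilon> x y z (p + 1) q r - borcherds_defect \<epsilon> x y z p (q + 1) r"
proof -
  have "(-1) powi (r + 1) = - ((-1) powi r :: 'k)" by (simp add: minus_one_powi)
  then show ?thesis
    unfolding borcherds_defect_def ord_prod_Suc nested_prod_Suc by (simp add: scale_right_diff_distrib)
qed

text \<open>Locality of order \<open>M\<close> is the vanishing of the right-hand side of the Borcherds identity at \<open>r = M\<close>.\<close>

lemma local_iff_ord_prod:
  "local_of_order A \<epsilon> x y M \<longleftrightarrow> (\<forall>z p q. ord_prod x y z p q M = (\<epsilon> * (-1) powi M) *s ord_prod y x z q p M)"
proof -
  have L: "Sum_any (\<lambda>i::nat. ((-1) ^ i * (of_int M gchoose i)) *s (x \<cdot>\<^bsub>p + M - int i\<^esub> (y \<cdot>\<^bsub>q + int i\<^esub> z)))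
     = ord_prod x y z p q M" for x y z p q
    unfolding ord_prod_def bsum_def by (simp add: mult.commute)
  have R: "\<epsilon> *s Sum_any (\<lambda>i::nat. ((-1) powi (M - int i) * (of_int M gchoose i)) *s (y \<cdot>\<^bsub>q + M - int i\<^esub> (x \<cdot>\<^bsub>p + int i\<^esub> z)))
     = (\<epsilon> * (-1) powi M) *s ord_prod y x z q p M" for z p q
  proof -
    obtain K where "\<forall>i\<ge>K. (-1) ^ i *s y \<cdot>\<^bsub>q + M - int i\<^esub> x \<cdot>\<^bsub>p + int i\<^esub> z = 0"
      using ord_prod_tail by blast
    then have K: "\<And>i. i \<ge> K \<Longrightarrow> y \<cdot>\<^bsub>q + M - int i\<^esub> x \<cdot>\<^bsub>p + int i\<^esub> z = 0" by simp
    have "Sum_any (\<lambda>i::nat. ((-1) powi (M - int i) * (of_int M gchoose i)) *s (y \<cdot>\<^bsub>q + M - int i\<^esub> (x \<cdot>\<^bsub>p + int i\<^esub> z)))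
      = (\<Sum>i<K. ((-1) powi (M - int i) * (of_int M gchoose i)) *s (y \<cdot>\<^bsub>q + M - int i\<^esub> (x \<cdot>\<^bsub>p + int i\<^esub> z)))"
      using K by (intro Sum_any_lessThan) simp
    moreover have "ord_prod y x z q p M = (\<Sum>i<K. (of_int M gchoose i) *s (-1) ^ i *s (y \<cdot>\<^bsub>q + M - int i\<^esub> (x \<cdot>\<^bsub>p + int i\<^esub> z)))"
      unfolding ord_prod_def using K by (intro bsum_lessThan) simp
    ultimately show ?thesis by (simp add: scale_sum_right minus_one_powi mult_ac)
  qed
  show ?thesis unfolding local_of_order_def L R total by auto
qed

text \<open>Multiplying the locality identity by \<open>w - z\<close> preserves it.\<close>

lemma local_mono:
  assumes "local_of_order A \<epsilon> x y M" "M \<le> M'"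
  shows "local_of_order A \<epsilon> x y M'"
  using assms(2)
proof (induction rule: int_ge_induct)
  case (step i)
  then show ?case
    unfolding local_iff_ord_prod ord_prod_Suc by (simp add: minus_one_powi scale_right_diff_distrib)
qed (rule assms)


section \<open>From locality to the Borcherds identity\<close>

text \<open>
  Locality applied to the vacuum: at \<open>q = -1\<close> one side reduces to the single term \<open>x\<^sub>(\<^sub>n\<^sub>) y\<close>, while on the
  other side every mode \<open>x\<^sub>(\<^sub>p\<^sub>+\<^sub>i\<^sub>) 1\<close> is a divided derivative of \<open>x\<close>, past which \<open>y\<close> is commuted.
\<close>

lemma skew_symmetry_of_local:
  assumes loc: "local_of_order A \<epsilon> x y M" and M: "\<And>t. t \<ge> M \<Longrightarrow> y \<cdot>\<^bsub>t\<^esub> x = 0"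
    and K: "\<And>j. j \<ge> K \<Longrightarrow> y \<cdot>\<^bsub>n + int j\<^esub> x = 0"
  shows "x \<cdot>\<^bsub>n\<^esub> y = \<epsilon> *s (\<Sum>j<K. (-1) powi (n + int j + 1) *s Ddiv j (y \<cdot>\<^bsub>n + int j\<^esub> x))"
proof -
  \<comment> \<open>The modes \<open>x\<^sub>(\<^sub>p\<^sub>+\<^sub>i\<^sub>)\<close> with \<open>i \<ge> P\<close> kill the vacuum.\<close>
  define p where "p = n - M"
  define P where "P = nat (- p)"
  define t where "t i k = ((of_int M gchoose i) * (-1) ^ i * (of_int M - 1 - of_nat i gchoose k))
      *s Ddiv (P - 1 - (i + k)) (y \<cdot>\<^bsub>M - 1 - int (i + k)\<^esub> x)" for i k
  define u where "u s = Ddiv (P - 1 - s) (y \<cdot>\<^bsub>M - 1 - int s\<^esub> x)" for s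
  define f where "f j = (-1) powi (n + int j + 1) *s Ddiv j (y \<cdot>\<^bsub>n + int j\<^esub> x)" for j
  have "x \<cdot>\<^bsub>n\<^esub> y = ord_prod x y (vvac A) p (-1) M"
    using vac_right[of y 0] by (simp add: ord_prod_def bsum_lessThan[of 1] vac_right_nonneg p_def)
  also have "\<dots> = (\<epsilon> * (-1) powi M) *s ord_prod y x (vvac A) (-1) p M"
    using loc unfolding local_iff_ord_prod by blast
  also have "ord_prod y x (vvac A) (-1) p M = (\<Sum>i<P. (of_int M gchoose i) *s (-1) ^ i *s y \<cdot>\<^bsub>-1 + M - int i\<^esub> x \<cdot>\<^bsub>p + int i\<^esub> vvac A)"
    unfolding ord_prod_def by (rule bsum_lessThan) (simp add: vac_right_nonneg P_def)
  also have "\<dots> = (\<Sum>i<P. \<Sum>k<P. if i + k < P then t i k else 0)"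
  proof (intro sum.cong refl)
    fix i assume "i \<in> {..<P}"
    then have i: "i < P" by simp
    then have "p + int i = - int (P - 1 - i) - 1" by (simp add: P_def of_nat_diff)
    then have "x \<cdot>\<^bsub>p + int i\<^esub> vvac A = Ddiv (P - 1 - i) x" by (simp only: vac_right)
    then have "(of_int M gchoose i) *s (-1) ^ i *s y \<cdot>\<^bsub>-1 + M - int i\<^esub> x \<cdot>\<^bsub>p + int i\<^esub> vvac A
       = (\<Sum>k\<le>P - 1 - i. t i k)"
      by (simp add: Ddiv_right t_def scale_sum_right algebra_simps)
    also have "\<dots> = (\<Sum>k<P. if i + k < P then t i k else 0)"
      using i by (intro sum.mono_neutral_cong_left) auto
    finally show "(of_int M gchoose i) *s (-1) ^ i *s y \<cdot>\<^bsub>-1 + M - int i\<^esub> x \<cdot>\<^bsub>p + int i\<^esub> vvac A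
       = (\<Sum>k<P. if i + k < P then t i k else 0)" .
  qed
  also have "\<dots> = (\<Sum>s<P. \<Sum>i\<le>s. t i (s - i))"
    by (subst sum_triangle) auto
  also have "\<dots> = (\<Sum>s<P. (-1) ^ s *s u s)"
  proof (intro sum.cong refl)
    fix s
    have "(\<Sum>i\<le>s. t i (s - i)) = (\<Sum>i\<le>s. (-1) ^ s *
        ((of_int M gchoose i) * ((-1) ^ (s - i) * (of_int M - 1 - of_nat i gchoose (s - i))))) *s u s"
      unfolding scale_sum_left
      by (intro sum.cong refl) (auto simp: t_def u_def le_imp_diff_is_add minus_one_power_iff)
    also have "(\<Sum>i\<le>s. (-1) ^ s *
        ((of_int M gchoose i) * ((-1) ^ (s - i) * (of_int M - 1 - of_nat i gchoose (s - i))))) = ((-1) ^ s :: 'k)"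
      unfolding sum_distrib_left[symmetric] gbinomial_Vandermonde_alternating
      by (simp flip: binomial_gbinomial)
    finally show "(\<Sum>i\<le>s. t i (s - i)) = (-1) ^ s *s u s" .
  qed
  also have "\<dots> = (\<Sum>j<P. (-1) ^ (P - Suc j) *s u (P - Suc j))"
    by (rule sum.nat_diff_reindex[symmetric])
  finally have "x \<cdot>\<^bsub>n\<^esub> y = \<epsilon> *s (\<Sum>j<P. ((-1) powi M * (-1) ^ (P - Suc j)) *s u (P - Suc j))"
    by (simp add: scale_sum_right mult_ac)
  also have "(\<Sum>j<P. ((-1) powi M * (-1) ^ (P - Suc j)) *s u (P - Suc j)) = (\<Sum>j<P. f j)"
  proof (intro sum.cong refl)
    fix j assume "j \<in> {..<P}"
    then have j: "j < P" by simp
    have e: "M - 1 - int (P - Suc j) = n + int j" "P - 1 - (P - Suc j) = j"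
      using j by (auto simp: P_def p_def of_nat_diff)
    have "(-1) powi M * (-1) ^ (P - Suc j) = ((-1) powi (M - int (P - Suc j)) :: 'k)"
      by (simp only: minus_one_powi)
    also have "M - int (P - Suc j) = n + int j + 1" using e(1) by simp
    finally show "((-1) powi M * (-1) ^ (P - Suc j)) *s u (P - Suc j) = f j"
      unfolding u_def f_def e by simp
  qed
  also have "\<dots> = (\<Sum>j<max P K. f j)"
    using M by (intro sum.mono_neutral_left) (auto simp: f_def P_def p_def Ddiv_linear)
  also have "\<dots> = (\<Sum>j<K. f j)"
    using K by (intro sum.mono_neutral_right) (auto simp: f_def Ddiv_linear)
  finally show ?thesis by (simp add: f_def)
qed

lemma skew_symmetry:
  assumes "x \<in> vpart A i" "y \<in> vpart A j" "\<And>l. l \<ge> K \<Longrightarrow> y \<cdot>\<^bsub>n + int l\<^esub> x = 0"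
  shows "x \<cdot>\<^bsub>n\<^esub> y = (-1) powi (i * j) *s (\<Sum>l<K. (-1) powi (n + int l + 1) *s Ddiv l (y \<cdot>\<^bsub>n + int l\<^esub> x))"
proof -
  obtain M where M: "local_of_order A ((-1) powi (i * j)) x y M" by (rule locality[OF assms(1,2)])
  obtain m where m: "\<And>t. t \<ge> m \<Longrightarrow> y \<cdot>\<^bsub>t\<^esub> x = 0" using nprod_bounded[of y x] by blast
  have "local_of_order A ((-1) powi (i * j)) x y (max m M)" by (rule local_mono[OF M]) simp
  then show ?thesis by (rule skew_symmetry_of_local) (use m assms in auto)
qed

text \<open>
  Locality of \<open>x\<close> and \<open>z\<close> becomes associativity after skew-symmetry: writing \<open>(x\<^sub>(\<^sub>i\<^sub>) y)\<^sub>(\<^sub>j\<^sub>) z\<close> through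
  \<open>z\<^sub>(\<^sub>l\<^sub>) (x\<^sub>(\<^sub>i\<^sub>) y)\<close> and \<open>x\<^sub>(\<^sub>i\<^sub>) (y\<^sub>(\<^sub>j\<^sub>) z)\<close> through \<open>x\<^sub>(\<^sub>i\<^sub>) (z\<^sub>(\<^sub>l\<^sub>) y)\<close> turns the two sides into the coefficients
  of \<open>e\<^sup>z\<^sup>D\<close> applied to the two sides of locality of order \<open>p\<close> on the vector \<open>y\<close>.
\<close>

lemma weak_associativity:
  assumes x: "x \<in> vpart A i" and y: "y \<in> vpart A j" and z: "z \<in> vpart A k"
    and loc: "local_of_order A ((-1) powi (i * k)) x z p"
  shows "nested_prod x y z p q r = ord_prod x y z p q r"
proof -
  have tail: "\<exists>K. \<forall>l\<ge>K. u \<cdot>\<^bsub>s + int l\<^esub> v = 0" for u v s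
  proof -
    obtain m where m: "\<And>n. n \<ge> m \<Longrightarrow> u \<cdot>\<^bsub>n\<^esub> v = 0" using nprod_bounded[of u v] by blast
    have "\<forall>l\<ge>nat (m - s). u \<cdot>\<^bsub>s + int l\<^esub> v = 0" by (auto intro!: m)
    then show ?thesis by blast
  qed
  obtain I where I: "\<And>l. l \<ge> I \<Longrightarrow> x \<cdot>\<^bsub>r + int l\<^esub> y = 0" using tail by blast
  obtain K0 where K0: "\<And>l. l \<ge> K0 \<Longrightarrow> z \<cdot>\<^bsub>q + int l\<^esub> y = 0" using tail by blast
  have "\<forall>\<^sub>F l in sequentially. \<forall>i\<in>{..<I}. z \<cdot>\<^bsub>p + q - int i + int l\<^esub> x \<cdot>\<^bsub>r + int i\<^esub> y = 0"
    using tail by (intro eventually_ball_finite) (auto simp: eventually_sequentially)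
  then obtain K1 where K1: "\<And>i l. i < I \<Longrightarrow> l \<ge> K1 \<Longrightarrow> z \<cdot>\<^bsub>p + q - int i + int l\<^esub> x \<cdot>\<^bsub>r + int i\<^esub> y = 0"
    unfolding eventually_sequentially by blast
  \<comment> \<open>Only \<open>i < I\<close> gives nonzero \<open>x\<^sub>(\<^sub>r\<^sub>+\<^sub>i\<^sub>) y\<close>, so one bound truncates all the sums at once.\<close>
  define K where "K = max I (max K0 K1)"
  have KI: "x \<cdot>\<^bsub>r + int l\<^esub> y = 0" if "l \<ge> K" for l using I that by (simp add: K_def)
  have KL: "z \<cdot>\<^bsub>p + q - int i + int l\<^esub> x \<cdot>\<^bsub>r + int i\<^esub> y = 0" if "l \<ge> K" for i l
    using K1[of i l] I[of i] that by (cases "i < I") (auto simp: K_def)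
  have KR: "z \<cdot>\<^bsub>q + int l\<^esub> y = 0" if "l \<ge> K" for l using K0 that by (simp add: K_def)
  define c where "c l = (-1) powi (j * k) * ((-1) powi (q + int l + 1) :: 'k)" for l
  have swap: "ord_prod z x y (q + int l) r p = ((-1) powi (i * k) * (-1) powi p) *s ord_prod x z y r (q + int l) p" for l
    using loc unfolding local_iff_ord_prod by (simp add: minus_one_powi mult_ac)

  have sg: "(-1) powi ((i + j) * k) = ((-1) powi (i * k) * (-1) powi (j * k) :: 'k)"
    by (simp add: distrib_right minus_one_powi(1))
  have "nested_prod x y z p q r = (\<Sum>i<K. (of_int p gchoose i) *s (x \<cdot>\<^bsub>r + int i\<^esub> y) \<cdot>\<^bsub>p + q - int i\<^esub> z)"
    unfolding nested_prod_def by (rule bsum_lessThan) (simp add: KI)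
  also have "\<dots> = (\<Sum>i'<K. (of_int p gchoose i') *s (-1) powi ((i + j) * k) *s
      (\<Sum>l<K. (-1) powi (p + q - int i' + int l + 1) *s Ddiv l (z \<cdot>\<^bsub>p + q - int i' + int l\<^esub> x \<cdot>\<^bsub>r + int i'\<^esub> y)))"
    by (intro sum.cong refl arg_cong2[where f = scl] skew_symmetry z va_unfold(6)[OF va] x y KL)
  also have "\<dots> = (\<Sum>l<K. \<Sum>i'<K. ((of_int p gchoose i') * (-1) powi ((i + j) * k) * (-1) powi (p + q - int i' + int l + 1)) *s
      Ddiv l (z \<cdot>\<^bsub>p + q - int i' + int l\<^esub> x \<cdot>\<^bsub>r + int i'\<^esub> y))"
    unfolding scale_sum_right scale_scale by (subst sum.swap) (simp add: mult_ac)
  also have "\<dots> = (\<Sum>l<K. ((-1) powi ((i + j) * k) * (-1) powi p * (-1) powi (q + int l + 1)) *s Ddiv l (ord_prod z x y (q + int l) r p))"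
  proof (intro sum.cong refl)
    fix l
    have ord: "ord_prod z x y (q + int l) r p
       = (\<Sum>i<K. (of_int p gchoose i) *s (-1) ^ i *s z \<cdot>\<^bsub>q + int l + p - int i\<^esub> x \<cdot>\<^bsub>r + int i\<^esub> y)"
      unfolding ord_prod_def by (rule bsum_lessThan) (simp add: KI)
    have idx: "p + q - int i + int l = q + int l + p - int i" for i by simp
    show "(\<Sum>i'<K. ((of_int p gchoose i') * (-1) powi ((i + j) * k) * (-1) powi (p + q - int i' + int l + 1)) *s
      Ddiv l (z \<cdot>\<^bsub>p + q - int i' + int l\<^esub> x \<cdot>\<^bsub>r + int i'\<^esub> y))
      = ((-1) powi ((i + j) * k) * (-1) powi p * (-1) powi (q + int l + 1)) *s Ddiv l (ord_prod z x y (q + int l) r p)"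
      unfolding ord idx by (simp add: Ddiv_linear scale_sum_right minus_one_powi mult_ac)
  qed
  also have "\<dots> = (\<Sum>l<K. c l *s Ddiv l (ord_prod x z y r (q + int l) p))"
    unfolding swap Ddiv_linear sg by (simp add: c_def minus_one_powi mult_ac)
  finally have L: "nested_prod x y z p q r = (\<Sum>l<K. c l *s Ddiv l (ord_prod x z y r (q + int l) p))" .

  \<comment> \<open>Index \<open>i\<close> comes from the binomial series, \<open>k + l\<close> from skew-symmetry, and \<open>k\<close> counts the derivatives
    absorbed by the mode of \<open>x\<close>; summing over \<open>i + k = s\<close> leaves the coefficient of \<open>D\<^sup>(\<^sup>l\<^sup>)\<close>.\<close>
  define T where "T i k l = ((of_int r gchoose i) * (-1) ^ i * (-1) powi (q + int (i + k + l) + 1) * (of_int p + of_int r - of_nat i gchoose k))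
      *s Ddiv l (x \<cdot>\<^bsub>p + r - int (i + k)\<^esub> z \<cdot>\<^bsub>q + int (i + k + l)\<^esub> y)" for i k l
  have T0: "T i k l = 0" if "i + k + l \<ge> K" for i k l
    using KR[OF that] by (simp add: T_def Ddiv_linear)
  have "ord_prod x y z p q r = (\<Sum>i<K. (of_int r gchoose i) *s (-1) ^ i *s x \<cdot>\<^bsub>p + r - int i\<^esub> y \<cdot>\<^bsub>q + int i\<^esub> z)
    \<and> (\<forall>i. y \<cdot>\<^bsub>q + int i\<^esub> z = (-1) powi (j * k) *s (\<Sum>m<K. (-1) powi (q + int i + int m + 1) *s Ddiv m (z \<cdot>\<^bsub>q + int (i + m)\<^esub> y)))"
  proof -
    have *: "y \<cdot>\<^bsub>q + int i\<^esub> z = (-1) powi (j * k) *s (\<Sum>m<K. (-1) powi (q + int i + int m + 1) *s Ddiv m (z \<cdot>\<^bsub>q + int (i + m)\<^esub> y))" for i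
      using skew_symmetry[OF y z, of K "q + int i"] KR[of "i + _"] by (simp add: add.assoc)
    have "y \<cdot>\<^bsub>q + int i\<^esub> z = 0" if "i \<ge> K" for i
      unfolding * using KR[of "i + _"] that by (simp add: Ddiv_linear)
    then have "ord_prod x y z p q r = (\<Sum>i<K. (of_int r gchoose i) *s (-1) ^ i *s x \<cdot>\<^bsub>p + r - int i\<^esub> y \<cdot>\<^bsub>q + int i\<^esub> z)"
      unfolding ord_prod_def by (intro bsum_lessThan) simp
    with * show ?thesis by blast
  qed
  then have "ord_prod x y z p q r = (-1) powi (j * k) *s (\<Sum>i<K. \<Sum>m<K. \<Sum>k\<le>m. T i k (m - k))"
    apply (simp add: T_def nprod_scale nprod_sum Ddiv_right scale_sum_right)
    apply (intro sum.cong refl)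
    apply (simp add: algebra_simps)
    done
  also have "(\<Sum>i<K. \<Sum>m<K. \<Sum>k\<le>m. T i k (m - k)) = (\<Sum>i<K. \<Sum>k<K. \<Sum>l<K. T i k l)"
    using T0 by (intro sum.cong refl sum_triangle[symmetric]) simp
  also have "\<dots> = (\<Sum>i<K. \<Sum>l<K. \<Sum>k<K. T i k l)"
    by (intro sum.cong refl sum.swap)
  also have "\<dots> = (\<Sum>l<K. \<Sum>i<K. \<Sum>k<K. T i k l)"
    by (rule sum.swap)
  also have "\<dots> = (\<Sum>l<K. \<Sum>s<K. \<Sum>i\<le>s. T i (s - i) l)"
    using T0 by (intro sum.cong refl sum_triangle) simp
  also have "\<dots> = (\<Sum>l<K. (-1) powi (q + int l + 1) *s Ddiv l (ord_prod x z y r (q + int l) p))"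
  proof (intro sum.cong refl)
    fix l
    have "(\<Sum>i\<le>s. T i (s - i) l) = ((-1) powi (q + int l + 1) * ((of_int p gchoose s) * (-1) ^ s)) *s
        Ddiv l (x \<cdot>\<^bsub>r + p - int s\<^esub> z \<cdot>\<^bsub>q + int l + int s\<^esub> y)" (is "_ = _ *s ?w") for s
    proof -
      have "(\<Sum>i\<le>s. T i (s - i) l) = (\<Sum>i\<le>s. (-1) powi (q + int l + 1) *
        ((of_int r gchoose i) * ((-1) ^ (s - i) * (of_int p + of_int r - of_nat i gchoose (s - i))))) *s ?w"
        unfolding scale_sum_left
      proof (intro sum.cong refl)
        fix i assume "i \<in> {..s}"
        then obtain k where s: "s = i + k" using le_Suc_ex by auto
        show "T i (s - i) l = ((-1) powi (q + int l + 1) *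
          ((of_int r gchoose i) * ((-1) ^ (s - i) * (of_int p + of_int r - of_nat i gchoose (s - i))))) *s ?w"
          unfolding T_def s by (simp add: minus_one_powi power_add algebra_simps flip: power_mult_distrib)
      qed
      also have "(\<Sum>i\<le>s. (-1) powi (q + int l + 1) *
        ((of_int r gchoose i) * ((-1) ^ (s - i) * (of_int p + of_int r - of_nat i gchoose (s - i)))))
        = (-1) powi (q + int l + 1) * (of_nat s - of_int p - 1 gchoose s :: 'k)"
        unfolding sum_distrib_left[symmetric] gbinomial_Vandermonde_alternating by (simp add: algebra_simps)
      also have "(of_nat s - of_int p - 1 gchoose s) = (of_int p gchoose s) * (-1 :: 'k) ^ s"
        by (subst (2) gbinomial_negated_upper) (simp flip: power_mult_distrib)
      finally show ?thesis .
    qed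
    moreover have "ord_prod x z y r (q + int l) p
       = (\<Sum>s<K. (of_int p gchoose s) *s (-1) ^ s *s x \<cdot>\<^bsub>r + p - int s\<^esub> z \<cdot>\<^bsub>q + int l + int s\<^esub> y)"
      unfolding ord_prod_def using KR[of "l + _"] by (intro bsum_lessThan) (simp add: add.assoc)
    ultimately show "(\<Sum>s<K. \<Sum>i\<le>s. T i (s - i) l) = (-1) powi (q + int l + 1) *s Ddiv l (ord_prod x z y r (q + int l) p)"
      by (simp add: Ddiv_linear scale_sum_right)
  qed
  finally show ?thesis unfolding L by (simp add: scale_sum_right c_def)
qed

text \<open>
  The defect vanishes for large \<open>r\<close> by locality of \<open>x\<close> and \<open>y\<close>, and for one value \<open>p\<^sub>0\<close> of \<open>p\<close> by weak
  associativity.  If it vanishes at \<open>r + 1\<close>, the recursion says that at \<open>r\<close> it depends on \<open>p + q\<close>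
  only, so the value at \<open>p\<^sub>0\<close> decides; hence downward induction on \<open>r\<close> applies.
\<close>

theorem borcherds_identity:
  assumes x: "x \<in> vpart A i" and y: "y \<in> vpart A j"
  shows "nested_prod x y z p q r = ord_prod x y z p q r - ((-1) powi (i * j) * (-1) powi r) *s ord_prod y x z q p r"
proof -
  define J where "J = borcherds_defect ((-1) powi (i * j)) x y"
  have hom: "J z p q r = 0" if z: "z \<in> vpart A k" for z k p q r
  proof -
    obtain M where M: "local_of_order A ((-1) powi (i * j)) x y M" by (rule locality[OF x y])
    obtain m where m: "\<And>t. t \<ge> m \<Longrightarrow> x \<cdot>\<^bsub>t\<^esub> y = 0" using nprod_bounded[of x y] by blast
    obtain P where P: "local_of_order A ((-1) powi (i * k)) x z P" by (rule locality[OF x z])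
    obtain P' where P': "\<And>t. t \<ge> P' \<Longrightarrow> x \<cdot>\<^bsub>t\<^esub> z = 0" using nprod_bounded[of x z] by blast
    define p0 where "p0 = max P P'"
    have p0: "local_of_order A ((-1) powi (i * k)) x z p0" by (rule local_mono[OF P]) (simp add: p0_def)
    have assoc: "J z p0 q r = 0" for q r
    proof -
      have "ord_prod y x z q p0 r = 0"
        unfolding ord_prod_def by (subst bsum_lessThan[of 0]) (simp_all add: P' p0_def)
      then show ?thesis unfolding J_def borcherds_defect_def weak_associativity[OF x y z p0] by simp
    qed
    have large: "J z p q r = 0" if "r \<ge> max M m" for p q r
    proof -
      have "nested_prod x y z p q r = 0"
        unfolding nested_prod_def by (subst bsum_lessThan[of 0]) (use m that in simp_all)
      then show ?thesis
        using local_mono[OF M, of r] that unfolding J_def borcherds_defect_def local_iff_ord_prod by simp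
    qed
    have "J z p q (max M m - int d) = 0" for d p q
    proof (induction d arbitrary: p q)
      case (Suc d)
      define r where "r = max M m - int (Suc d)"
      have "J z p q (r + 1) = 0" for p q using Suc[of p q] by (simp add: r_def algebra_simps)
      then have step: "J z (p + 1) q r = J z p (q + 1) r" for p q
        using borcherds_defect_Suc[of "(-1) powi (i * j)" x y z p q r] by (simp add: J_def)
      have up: "J z (p + int t) q r = J z p (q + int t) r" for p q t
      proof (induction t arbitrary: p q)
        case (Suc t)
        then show ?case using step[of "p + int t" q] Suc[of p "q + 1"] by (simp add: algebra_simps)
      qed simp
      have "J z p q r = 0"
      proof (cases "p \<le> p0")
        case True
        then show ?thesis using up[of p "nat (p0 - p)" "q - (p0 - p)"] assoc[of "q - (p0 - p)" r] by simp
      next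
        case False
        then show ?thesis using up[of p0 "nat (p - p0)" q] assoc by simp
      qed
      then show ?case by (simp add: r_def)
    qed (simp add: large)
    from this[of p q "nat (max M m - r)"] show ?thesis
      using large[of r p q] by (cases "r \<ge> max M m") simp_all
  qed
  have add: "J (z + z') p q r = J z p q r + J z' p q r" for z z'
  proof -
    have badd: "bsum s (\<lambda>i. g i + h i) = bsum s g + bsum s h" if gh: "\<exists>K. \<forall>i\<ge>K. g i = 0" "\<exists>K. \<forall>i\<ge>K. h i = 0" for s g h
    proof -
      obtain K K' where K: "\<forall>i\<ge>K. g i = 0" "\<forall>i\<ge>K'. h i = 0" using gh by blast
      show ?thesis
        using bsum_lessThan[of "max K K'" g s] bsum_lessThan[of "max K K'" h s]
          bsum_lessThan[of "max K K'" "\<lambda>i. g i + h i" s] K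
        by (simp add: scale_right_distrib sum.distrib)
    qed
    have "ord_prod x y (z + z') p q r = ord_prod x y z p q r + ord_prod x y z' p q r" for x y p q
      unfolding ord_prod_def nprod_add scale_right_distrib by (rule badd[OF ord_prod_tail ord_prod_tail])
    moreover have "nested_prod x y (z + z') p q r = nested_prod x y z p q r + nested_prod x y z' p q r"
      unfolding nested_prod_def nprod_add by (rule badd[OF nprod_tail(2) nprod_tail(2)])
    ultimately show ?thesis unfolding J_def borcherds_defect_def by (simp add: scale_right_distrib)
  qed
  obtain z0 z1 where "z0 \<in> vpart A 0" "z1 \<in> vpart A 1" "z = z0 + z1"
    using vcarrierE[of z A] total by auto
  then have "J z p q r = 0" by (simp add: add hom)
  then show ?thesis by (simp add: J_def borcherds_defect_def)
qed

corollary commutator_formula: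
  assumes "x \<in> vpart A i" "y \<in> vpart A j"
  shows "x \<cdot>\<^bsub>p\<^esub> y \<cdot>\<^bsub>q\<^esub> z = (-1) powi (i * j) *s y \<cdot>\<^bsub>q\<^esub> x \<cdot>\<^bsub>p\<^esub> z
    + bsum p (\<lambda>l. (x \<cdot>\<^bsub>int l\<^esub> y) \<cdot>\<^bsub>p + q - int l\<^esub> z)"
  using borcherds_identity[OF assms, of z p q 0]
    by (simp add: nested_prod_def ord_prod_def bsum_0 algebra_simps)

corollary associator_formula:
  assumes "x \<in> vpart A i" "y \<in> vpart A j"
  shows "(x \<cdot>\<^bsub>r\<^esub> y) \<cdot>\<^bsub>q\<^esub> z = bsum r (\<lambda>l. (-1) ^ l *s x \<cdot>\<^bsub>r - int l\<^esub> y \<cdot>\<^bsub>q + int l\<^esub> z)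
    - ((-1) powi (i * j) * (-1) powi r) *s bsum r (\<lambda>l. (-1) ^ l *s y \<cdot>\<^bsub>q + r - int l\<^esub> x \<cdot>\<^bsub>int l\<^esub> z)"
  using borcherds_identity[OF assms, of z 0 q r]
    by (simp add: nested_prod_def ord_prod_def bsum_0)

end


section \<open>The fermionic modes of the lattice vertex algebra\<close>

lemma lattice_VZ_total:
  assumes "lattice_VZ V"
  shows "total_vertex_algebra V"
proof
  show V: "vertex_algebra V" using assms by (simp add: lattice_VZ_def)
  interpret vector_space "vscale V" by (rule va_unfold[OF V])
  note sub = vcarrier_subspace[OF V]
  have "x \<in> vcarrier V" for x
  proof (induction x rule: fock_induct)
    case (single k r)
    obtain j l where k: "k = (j, l)" by (cases k)
    have "Poly_Mapping.single k r \<in> vpart V j"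
      using assms by (auto simp: vpart_def lattice_VZ_def fock_supp_def k)
    then show ?case by (rule vpart_carrier[OF V])
  qed (use subspace_add[OF sub] subspace_0[OF sub] in auto)
  then show "vcarrier V = UNIV" by auto
qed

locale lattice_vertex_algebra = total_vertex_algebra V for V :: "('k::field_char_0, 'k fock) valg" +
  assumes lattice: "lattice_VZ V"
begin

abbreviation V_scale (infixr "*s" 75) where "r *s x \<equiv> vscale V r x"

abbreviation V_prod ("(_ \<cdot>\<^bsub>_\<^esub>/ _)" [77, 0, 76] 76) where "x \<cdot>\<^bsub>n\<^esub> y \<equiv> vprod V x n y"

lemma vvac_V: "vvac V = vtop 0"
  using lattice by (simp add: lattice_VZ_def)

lemma vtop_part: "vtop j \<in> vpart V j"
  using lattice by (auto simp: vpart_def lattice_VZ_def fock_supp_def vtop_def)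

lemma vtop_prod_zero: "n \<ge> - i * j \<Longrightarrow> vtop i \<cdot>\<^bsub>n\<^esub> vtop j = 0"
  using lattice by (simp add: lattice_VZ_def)

lemma vtop_prod_top: "vtop i \<cdot>\<^bsub>- i * j - 1\<^esub> vtop j = vtop (i + j)"
proof -
  have "vtop i \<cdot>\<^bsub>- i * j - int 0 - 1\<^esub> vtop j = vscale V (1 / fact 0) (((\<lambda>x. vD V x - heis (of_int j) (-1) x) ^^ 0) (vtop (i + j)))"
    using lattice unfolding lattice_VZ_def by metis
  then show ?thesis by simp
qed

abbreviation psi :: "int \<Rightarrow> 'k fock \<Rightarrow> 'k fock" where "psi n x \<equiv> vtop 1 \<cdot>\<^bsub>n\<^esub> x"

lemma psi_anticommute: "psi m (psi n x) = - psi n (psi m x)"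
proof -
  have "bsum m (\<lambda>l. (vtop 1 \<cdot>\<^bsub>int l\<^esub> vtop 1) \<cdot>\<^bsub>m + n - int l\<^esub> x) = 0"
    by (subst bsum_lessThan[of 0]) (simp_all add: vtop_prod_zero)
  then show ?thesis
    using commutator_formula[OF vtop_part vtop_part, of 1 m 1 n x] scale_minus_left[of 1] scale_one by simp
qed

lemma Wp_part: "Wp V m \<in> vpart V 0"
  unfolding Wp_def using va_unfold(6)[OF va vtop_part vtop_part, of "-1" _ 1] by simp

text \<open>
  In the associator of \<open>v\<^sub>-\<^sub>1, v\<^sub>1, v\<^sub>1\<close> the modes \<open>v\<^sub>1\<^sub>(\<^sub>i\<^sub>) v\<^sub>1\<close> with \<open>i \<ge> 0\<close> vanish, and the only nonnegative mode of
  \<open>v\<^sub>-\<^sub>1\<close> that survives on \<open>v\<^sub>1\<close> is \<open>v\<^sub>-\<^sub>1\<^sub>(\<^sub>0\<^sub>) v\<^sub>1 = 1\<close>.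
\<close>

lemma Wp_vtop: "Wp V m \<cdot>\<^bsub>int i\<^esub> vtop 1 = (-1) ^ Suc m *s psi (int i - int m - 1) (vvac V)"
proof -
  let ?r = "- int m - 1"
  have 1: "bsum ?r (\<lambda>l. (-1) ^ l *s vtop (-1) \<cdot>\<^bsub>?r - int l\<^esub> vtop 1 \<cdot>\<^bsub>int i + int l\<^esub> vtop 1) = 0"
    by (subst bsum_lessThan[of 0]) (simp_all add: vtop_prod_zero)
  have "bsum ?r (\<lambda>l. (-1) ^ l *s vtop 1 \<cdot>\<^bsub>int i + ?r - int l\<^esub> vtop (-1) \<cdot>\<^bsub>int l\<^esub> vtop 1)
    = vtop 1 \<cdot>\<^bsub>int i + ?r\<^esub> vtop 0"
    using vtop_prod_top[of "-1" 1]
    by (subst bsum_eq_single) (simp_all add: vtop_prod_zero)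
  moreover have "int i + ?r = int i - int m - 1" by simp
  ultimately have 2: "bsum ?r (\<lambda>l. (-1) ^ l *s vtop 1 \<cdot>\<^bsub>int i + ?r - int l\<^esub> vtop (-1) \<cdot>\<^bsub>int l\<^esub> vtop 1)
    = psi (int i - int m - 1) (vvac V)" by (simp only: vvac_V)
  have "(-1) powi ?r = ((-1) ^ Suc m :: 'k)"
    using minus_one_powi(2)[of "- int m" 1, where ?'k = 'k] minus_one_powi(2)[of 0 "int m", where ?'k = 'k]
    by (simp add: minus_one_powi(3))
  moreover have "(-1) powi (-1 * 1) = (-1 :: 'k)" by simp
  ultimately have sgn: "- ((-1) powi (-1 * 1) * (-1) powi ?r) = ((-1) ^ Suc m :: 'k)" by simp
  show ?thesis
    unfolding Wp_def associator_formula[OF vtop_part vtop_part] 1 2 sgn[symmetric]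
    by (simp only: scale_minus_left diff_0)
qed

text \<open>
  The first \<open>m + 1\<close> products \<open>p\<^sub>m\<^sub>(\<^sub>l\<^sub>) v\<^sub>1\<close> are multiples of divided derivatives of \<open>v\<^sub>1\<close>, the others
  are zero; the Vandermonde convolution collects the commutator formula into one binomial coefficient.
\<close>

lemma Wp_psi_commutator:
  "Wp V m \<cdot>\<^bsub>int n\<^esub> psi s x = psi s (Wp V m \<cdot>\<^bsub>int n\<^esub> x)
     + ((-1) ^ Suc m * (of_int (int m - s - 1) gchoose m)) *s psi (s + int n - int m) x"
proof -
  have low: "Wp V m \<cdot>\<^bsub>int l\<^esub> vtop 1 = (-1) ^ Suc m *s Ddiv (m - l) (vtop 1)" if "l \<le> m" for l
  proof -
    have "int l - int m - 1 = - int (m - l) - 1" using that by simp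
    then show ?thesis unfolding Wp_vtop by (simp only: vac_right)
  qed
  have high: "Wp V m \<cdot>\<^bsub>int l\<^esub> vtop 1 = 0" if "l > m" for l
    using that unfolding Wp_vtop by (subst vac_right_nonneg) auto
  have "bsum (int n) (\<lambda>l. (Wp V m \<cdot>\<^bsub>int l\<^esub> vtop 1) \<cdot>\<^bsub>int n + s - int l\<^esub> x)
     = (\<Sum>l<Suc m. (of_int (int n) gchoose l) *s (Wp V m \<cdot>\<^bsub>int l\<^esub> vtop 1) \<cdot>\<^bsub>int n + s - int l\<^esub> x)"
    by (rule bsum_lessThan) (simp add: high)
  also have "\<dots> = (\<Sum>l\<le>m. (-1) ^ Suc m * ((of_int (int n) gchoose l) *
      ((-1) ^ (m - l) * (of_int (int n + s) - of_nat l gchoose (m - l))))) *s psi (s + int n - int m) x"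
    unfolding lessThan_Suc_atMost scale_sum_left
  proof (intro sum.cong refl)
    fix l assume "l \<in> {..m}"
    then have l: "l \<le> m" by simp
    then have "int n + s - int l - int (m - l) = s + int n - int m" by simp
    then show "(of_int (int n) gchoose l) *s (Wp V m \<cdot>\<^bsub>int l\<^esub> vtop 1) \<cdot>\<^bsub>int n + s - int l\<^esub> x
      = ((-1) ^ Suc m * ((of_int (int n) gchoose l) *
      ((-1) ^ (m - l) * (of_int (int n + s) - of_nat l gchoose (m - l))))) *s psi (s + int n - int m) x"
      unfolding low[OF l] nprod_scale Ddiv_left scale_scale by (simp only: of_int_diff of_int_of_nat_eq mult_ac)
  qed
  also have "(\<Sum>l\<le>m. (-1) ^ Suc m * ((of_int (int n) gchoose l) *
      ((-1) ^ (m - l) * (of_int (int n + s) - of_nat l gchoose (m - l)))))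
    = (-1) ^ Suc m * (of_int (int m - s - 1) gchoose m :: 'k)"
    unfolding sum_distrib_left[symmetric] gbinomial_Vandermonde_alternating by (simp add: algebra_simps)
  finally show ?thesis
    using commutator_formula[OF Wp_part vtop_part, of m "int n" 1 s x] scale_one by simp
qed

definition mon :: "int list \<Rightarrow> 'k fock" where "mon ns = foldr psi ns (vvac V)"

definition mon_span :: "nat \<Rightarrow> 'k fock set" where "mon_span k = span (mon ` {ns. length ns = k})"

lemma mon_simps [simp]: "mon [] = vvac V" "mon (n # ns) = psi n (mon ns)"
  by (simp_all add: mon_def)

lemma subspace_mon_span: "subspace (mon_span k)" by (simp add: mon_span_def)

lemma mon_in_span: "mon ns \<in> mon_span (length ns)"
  unfolding mon_span_def by (intro span_base) auto

lemma nprod_vimage_subspace: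
  "subspace S \<Longrightarrow> subspace {y. x \<cdot>\<^bsub>n\<^esub> y \<in> S}" "subspace S \<Longrightarrow> subspace {x. x \<cdot>\<^bsub>n\<^esub> y \<in> S}"
  by (auto intro!: subspaceI simp: nprod_add nprod_scale subspace_0 subspace_add subspace_scale)

lemma psi_mon_span: "x \<in> mon_span k \<Longrightarrow> psi n x \<in> mon_span (Suc k)"
proof -
  have "mon ` {ns. length ns = k} \<subseteq> {x. psi n x \<in> mon_span (Suc k)}"
    using mon_in_span[of "n # _"] by auto
  then have "mon_span k \<subseteq> {x. psi n x \<in> mon_span (Suc k)}"
    unfolding mon_span_def[of k] by (intro span_minimal nprod_vimage_subspace subspace_mon_span)
  then show "x \<in> mon_span k \<Longrightarrow> psi n x \<in> mon_span (Suc k)" by auto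
qed

lemma mon_part: "mon ns \<in> vpart V (int (length ns))"
proof (induction ns)
  case Nil
  then show ?case using vtop_part[of 0] by (simp add: vvac_V)
next
  case (Cons n ns)
  then show ?case using va_unfold(6)[OF va vtop_part[of 1] Cons] by (simp add: add.commute)
qed

text \<open>
  The associator formula expresses modes of \<open>\<psi>(n) x\<close> through those of \<open>x\<close> and of \<open>v\<^sub>1\<close>, hence the
  induction on the length of the left factor.
\<close>

lemma mon_prod_span: "y \<in> mon_span l \<Longrightarrow> mon ns \<cdot>\<^bsub>q\<^esub> y \<in> mon_span (length ns + l)"
proof (induction ns arbitrary: q y l)
  case Nil
  then show ?case using subspace_0[OF subspace_mon_span] by (simp add: vac_left)
next
  case (Cons n ns)
  have "psi i (mon ns \<cdot>\<^bsub>j\<^esub> y) \<in> mon_span (length (n # ns) + l)" for i j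
    using psi_mon_span[OF Cons.IH[OF Cons.prems]] by simp
  moreover have "mon ns \<cdot>\<^bsub>i\<^esub> psi j y \<in> mon_span (length (n # ns) + l)" for i j
    using Cons.IH[OF psi_mon_span[OF Cons.prems]] by simp
  ultimately show ?case
    unfolding mon_simps associator_formula[OF vtop_part mon_part]
    by (intro subspace_diff subspace_scale bsum_mem subspace_mon_span)
qed

lemma mon_span_prod:
  assumes "x \<in> mon_span k" "y \<in> mon_span l"
  shows "x \<cdot>\<^bsub>n\<^esub> y \<in> mon_span (k + l)"
proof -
  have "mon_span k \<subseteq> {x. x \<cdot>\<^bsub>n\<^esub> y \<in> mon_span (k + l)}"
    unfolding mon_span_def[of k]
    by (intro span_minimal nprod_vimage_subspace subspace_mon_span) (use mon_prod_span assms(2) in auto)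
  then show ?thesis using assms(1) by auto
qed

lemma vtop_mon: "vtop (int k) = mon (map (\<lambda>i. - int i - 1) (rev [0..<k]))"
proof (induction k)
  case (Suc k)
  then show ?case using vtop_prod_top[of 1 "int k"] by (simp add: add.commute)
qed (simp add: vvac_V)


section \<open>The action of \<open>W\<^sub>+\<close> on monomials\<close>

text \<open>
  The action on the monomials of the operator \<open>\<psi>(s) \<mapsto> f(s) \<psi>(s + d)\<close>, extended as a derivation.
\<close>

primrec act :: "(int \<Rightarrow> 'k) \<Rightarrow> int \<Rightarrow> int list \<Rightarrow> 'k fock" where
  "act f d [] = 0"
| "act f d (n # ns) = f n *s mon ((n + d) # ns) + psi n (act f d ns)"

lemma Wp_mon: "Wp V m \<cdot>\<^bsub>int n\<^esub> mon ns
  = (-1) ^ Suc m *s act (\<lambda>s. of_int (int m - s - 1) gchoose m) (int n - int m) ns"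
proof (induction ns)
  case Nil
  then show ?case by (simp add: vac_right_nonneg)
next
  case (Cons s ns)
  then show ?case
    by (simp add: Wp_psi_commutator nprod_scale scale_right_distrib nprod_minus add_ac add_diff_eq)
qed

lemma act_linear: "act (\<lambda>s. a * f s + b * g s) d ns = a *s act f d ns + b *s act g d ns"
  by (induction ns) (simp_all add: nprod_add nprod_scale scale_right_distrib scale_left_distrib
      scale_zero_right add_ac)

lemma act_span: "act f d ns \<in> mon_span (length ns)"
proof (induction ns)
  case (Cons n ns)
  then show ?case
    using mon_in_span[of "(n + d) # ns"] psi_mon_span[OF Cons, of n]
    by (auto intro!: subspace_add subspace_scale subspace_mon_span)
qed (simp add: subspace_0 subspace_mon_span)

lemma act_isolate:
  assumes "\<And>s. s \<in> set xs \<union> set ys \<Longrightarrow> f s = 0"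
  shows "act f d (xs @ n # ys) = f n *s mon (xs @ (n + d) # ys)"
proof -
  have "act f d ys = 0" if "\<And>s. s \<in> set ys \<Longrightarrow> f s = 0" for ys
    using that by (induction ys) auto
  then show ?thesis using assms
    by (induction xs) (auto simp: nprod_scale)
qed

lemma mon_span_stable: "x \<in> mon_span k \<Longrightarrow> Wp V m \<cdot>\<^bsub>int n\<^esub> x \<in> mon_span k"
proof -
  have "mon_span k \<subseteq> {x. Wp V m \<cdot>\<^bsub>int n\<^esub> x \<in> mon_span k}"
  proof -
    have "Wp V m \<cdot>\<^bsub>int n\<^esub> mon ns \<in> mon_span (length ns)" for ns
      unfolding Wp_mon by (intro subspace_scale subspace_mon_span act_span)
    then have "mon ` {ns. length ns = k} \<subseteq> {x. Wp V m \<cdot>\<^bsub>int n\<^esub> x \<in> mon_span k}" by auto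
    then show ?thesis
      unfolding mon_span_def[of k]
      by (intro span_minimal nprod_vimage_subspace) (simp_all add: mon_span_def)
  qed
  then show "x \<in> mon_span k \<Longrightarrow> Wp V m \<cdot>\<^bsub>int n\<^esub> x \<in> mon_span k" by auto
qed

lemma mon_Cons_eq_0:
  assumes "n \<in> set ns \<or> n \<ge> 0"
  shows "mon (n # ns) = 0"
  using assms
proof (induction ns)
  case Nil
  then show ?case by (simp add: vac_right_nonneg)
next
  case (Cons m ns)
  show ?case
  proof (cases "m = n")
    case True
    have "psi n (psi n (mon ns)) = - psi n (psi n (mon ns))" by (rule psi_anticommute)
    then have "(2 :: 'k) *s psi n (psi n (mon ns)) = 0"
      by (metis add.right_inverse one_add_one scale_left_distrib scale_one)
    then show ?thesis using True scale_eq_0_iff by auto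
  next
    case False
    then have "psi n (mon ns) = 0" using Cons by auto
    then show ?thesis using psi_anticommute[of n m "mon ns"] by simp
  qed
qed

lemma mon_eq_0:
  assumes "\<not> (distinct ns \<and> (\<forall>n\<in>set ns. n < 0))"
  shows "mon ns = 0"
  using assms
proof (induction ns)
  case (Cons n ns)
  show ?case
  proof (cases "n \<in> set ns \<or> n \<ge> 0")
    case False
    then have "mon ns = 0" using Cons by auto
    then show ?thesis by simp
  qed (rule mon_Cons_eq_0)
qed simp

text \<open>
  Multiplying \<open>(m-s-1 choose m)\<close> by a linear polynomial in \<open>s\<close> gives a combination of the same
  functions for \<open>m\<close> and \<open>m + 1\<close>.
\<close>

lemma gbinomial_mult_minus:
  "(of_int (int m - s - 1) gchoose m) * (of_int s - of_int u)
    = (of_int (int m - u)) * (of_int (int m - s - 1) gchoose m)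
      + (- of_nat (Suc m)) * (of_int (int (Suc m) - s - 1) gchoose Suc m :: 'k)"
proof -
  have "of_nat (Suc m) * ((of_int (int m - s - 1) + 1) gchoose Suc m) = (of_int (int m - s - 1) + 1) * (of_int (int m - s - 1) gchoose m :: 'k)"
    by (rule Suc_times_gbinomial)
  moreover have "of_int (int (Suc m) - s - 1) = (of_int (int m - s - 1) + 1 :: 'k)" by simp
  ultimately show ?thesis by (simp only: mult_minus_left) (simp add: algebra_simps)
qed

context
  fixes S :: "'k fock set"
  assumes S: "subspace S" and stable: "\<And>m n x. x \<in> S \<Longrightarrow> Wp V m \<cdot>\<^bsub>int n\<^esub> x \<in> S"
begin

text \<open>
  For \<open>U = {}\<close> this is, up to sign, the action of \<open>p\<^sub>m(m+d)\<close>, which exists in \<open>W\<^sub>+\<close> because \<open>m + d \<ge> 0\<close>.  The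
  induction raises \<open>m\<close> only, which keeps this condition.
\<close>

lemma act_stable:
  assumes "mon ns \<in> S" "finite U" "int m + d \<ge> 0"
  shows "act (\<lambda>s. (of_int (int m - s - 1) gchoose m) * (\<Prod>u\<in>U. of_int s - of_int u)) d ns \<in> S"
  using assms(2,3)
proof (induction U arbitrary: m rule: finite_induct)
  case empty
  define n where "n = nat (int m + d)"
  have d: "int n - int m = d" using empty by (simp add: n_def)
  have "(-1) ^ Suc m *s Wp V m \<cdot>\<^bsub>int n\<^esub> mon ns \<in> S" by (intro subspace_scale S stable assms)
  then show ?case
    unfolding Wp_mon d scale_scale by (simp add: scale_one flip: power_mult_distrib)
next
  case (insert u U)
  let ?c = "\<lambda>m s. (of_int (int m - s - 1) gchoose m :: 'k)" and ?p = "\<lambda>s. \<Prod>u\<in>U. of_int s - of_int u :: 'k"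
  have eq: "?c m s * (\<Prod>u\<in>insert u U. of_int s - of_int u)
    = of_int (int m - u) * (?c m s * ?p s) + (- of_nat (Suc m)) * (?c (Suc m) s * ?p s)" for s
    unfolding prod.insert[OF insert(1,2)] mult.assoc[symmetric] gbinomial_mult_minus distrib_right by (simp only: mult_ac)
  show ?case
    unfolding eq act_linear
    by (intro subspace_add subspace_scale S insert.IH) (use insert.prems in auto)
qed

text \<open>
  Taking \<open>U\<close> to be all the other modes isolates \<open>n\<close>.  The remaining factor \<open>(m-n-1 choose m)\<close> is
  nonzero because \<open>n < 0\<close>.
\<close>

lemma mon_move:
  assumes "mon (xs @ n # ys) \<in> S" "distinct (xs @ n # ys)" "n < 0"
  shows "mon (xs @ t # ys) \<in> S"
proof -
  \<comment> \<open>The least \<open>m\<close> for which the mode \<open>p\<^sub>m(m + d)\<close> belongs to \<open>W\<^sub>+\<close>.\<close>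
  define d where "d = t - n"
  define m where "m = nat (- d)"
  define f where "f s = (of_int (int m - s - 1) gchoose m) * (\<Prod>u\<in>set xs \<union> set ys. of_int s - of_int u :: 'k)" for s
  have "act f d (xs @ n # ys) = f n *s mon (xs @ (n + d) # ys)"
  proof (rule act_isolate)
    fix s assume "s \<in> set xs \<union> set ys"
    then show "f s = 0" unfolding f_def by (subst prod_zero) auto
  qed
  moreover have "act f d (xs @ n # ys) \<in> S"
    unfolding f_def by (rule act_stable) (use assms in \<open>auto simp: m_def\<close>)
  moreover have "f n \<noteq> 0"
  proof -
    have "int m - n - 1 = int (m + nat (- n - 1))" using assms(3) by simp
    then have "(of_int (int m - n - 1) gchoose m) = (of_nat (m + nat (- n - 1) choose m) :: 'k)"
      by (simp only: of_int_of_nat_eq binomial_gbinomial)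
    moreover have "m + nat (- n - 1) choose m \<noteq> 0" by simp
    ultimately show ?thesis unfolding f_def using assms(2) by auto
  qed
  ultimately have "(1 / f n) *s f n *s mon (xs @ (n + d) # ys) \<in> S" using subspace_scale[OF S] by metis
  then show ?thesis using \<open>f n \<noteq> 0\<close> unfolding scale_scale by (simp add: d_def scale_one)
qed

lemma mon_replace:
  assumes "length rs = length ts" "mon (xs @ rs) \<in> S" "distinct (xs @ rs)" "distinct (xs @ ts)"
    "set rs \<inter> set ts = {}" "\<forall>r\<in>set rs. r < 0"
  shows "mon (xs @ ts) \<in> S"
  using assms
proof (induction rs ts arbitrary: xs rule: list_induct2)
  case (Cons r rs t ts)
  have "mon (xs @ t # rs) \<in> S" by (rule mon_move) (use Cons.prems in auto)
  then have "mon ((xs @ [t]) @ ts) \<in> S"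
    by (intro Cons.IH) (use Cons.prems in auto)
  then show ?case by simp
qed simp

text \<open>
  A target monomial may share modes with \<open>v\<^sub>k\<close>, and \<open>mon_move\<close> applies only as long as the modes stay
  distinct; an intermediate monomial with unrelated modes avoids such collisions.
\<close>

lemma mon_span_subset:
  assumes "vtop (int k) \<in> S"
  shows "mon_span k \<subseteq> S"
  unfolding mon_span_def
proof (intro span_minimal S image_subsetI)
  fix ts :: "int list" assume "ts \<in> {ns. length ns = k}"
  then have len: "length ts = k" by simp
  define rs where "rs = map (\<lambda>i. - int i - 1) (rev [0..<k])"
  have rs: "distinct rs" "length rs = k" "\<forall>r\<in>set rs. r < 0" "mon rs \<in> S"
    using assms by (auto simp: rs_def distinct_map inj_on_def vtop_mon)
  show "mon ts \<in> S"
  proof (cases "distinct ts \<and> (\<forall>t\<in>set ts. t < 0)")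
    case True
    have "infinite ({..<0::int} - (set rs \<union> set ts))"
      by (intro Diff_infinite_finite) (auto simp: infinite_Iio)
    then obtain X where X: "finite X" "card X = k" "X \<subseteq> {..<0} - (set rs \<union> set ts)"
      using infinite_arbitrarily_large by blast
    obtain us where us: "set us = X" "distinct us" using finite_distinct_list[OF X(1)] by blast
    have "length us = k" using us X distinct_card by fastforce
    have disj: "set rs \<inter> set us = {}" "set us \<inter> set ts = {}" "\<forall>u\<in>set us. u < 0"
      using us(1) X(3) by auto
    have "mon ([] @ us) \<in> S"
      by (rule mon_replace[of rs]) (simp_all add: rs us disj[unfolded us] \<open>length us = k\<close>)
    then have "mon ([] @ ts) \<in> S"
      by (intro mon_replace[of us ts "[]"]) (simp_all add: us disj[unfolded us] len True \<open>length us = k\<close>)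
    then show ?thesis by simp
  qed (simp add: mon_eq_0 subspace_0[OF S])
qed

end

lemma UW_submodule_eq_mon_span: "UW_submodule V (vtop (int k)) = mon_span k"
proof
  have "vtop (int k) \<in> mon_span k"
    unfolding vtop_mon using mon_in_span[of "map (\<lambda>i. - int i - 1) (rev [0..<k])"] by simp
  then show "UW_submodule V (vtop (int k)) \<subseteq> mon_span k"
    unfolding UW_submodule_def by (intro Inter_lower) (simp add: subspace_mon_span mon_span_stable)
  show "mon_span k \<subseteq> UW_submodule V (vtop (int k))"
    unfolding UW_submodule_def by (intro Inter_greatest mon_span_subset) auto
qed

end


section \<open>The image of a weight component\<close>

lemma span_UN_subspaces:
  assumes "vector_space s" "\<And>k::nat. module.subspace s (H k)" "x \<in> module.span s (\<Union>k. H k)"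
  shows "\<exists>n. \<exists>h. (\<forall>k. h k \<in> H k) \<and> (\<forall>k\<ge>n. h k = 0) \<and> x = (\<Sum>k<n. h k)"
proof -
  interpret vector_space s by fact
  define P where "P x n h \<longleftrightarrow> (\<forall>k. h k \<in> H k) \<and> (\<forall>k\<ge>n. h k = 0) \<and> x = (\<Sum>k<n. h k)" for x h and n :: nat
  have mono: "P x n' h" if "P x n h" "n \<le> n'" for x n n' h
  proof -
    have "(\<Sum>k<n. h k) = (\<Sum>k<n'. h k)"
      using that by (intro sum.mono_neutral_left) (auto simp: P_def)
    then show ?thesis using that by (simp add: P_def)
  qed
  have "module.span s (\<Union>k. H k) \<subseteq> {x. \<exists>n h. P x n h}"
  proof (rule span_minimal)
    show "(\<Union>k. H k) \<subseteq> {x. \<exists>n h. P x n h}"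
    proof
      fix x assume "x \<in> (\<Union>k. H k)"
      then obtain k where "x \<in> H k" by blast
      then have "P x (Suc k) (\<lambda>i. if i = k then x else 0)"
        using assms(2) by (auto simp: P_def subspace_0)
      then show "x \<in> {x. \<exists>n h. P x n h}" by blast
    qed
    show "subspace {x. \<exists>n h. P x n h}"
    proof (rule subspaceI)
      have "P 0 0 (\<lambda>_. 0)" using assms(2) by (simp add: P_def subspace_0)
      then show "0 \<in> {x. \<exists>n h. P x n h}" by blast
    next
      fix x y assume "x \<in> {x. \<exists>n h. P x n h}" "y \<in> {x. \<exists>n h. P x n h}"
      then obtain m n g h where "P x m g" "P y n h" by blast
      then have "P x (max m n) g" "P y (max m n) h" using mono by (meson max.cobounded1 max.cobounded2)+
      then have "P (x + y) (max m n) (\<lambda>k. g k + h k)"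
        using assms(2) by (simp add: P_def subspace_add sum.distrib)
      then show "x + y \<in> {x. \<exists>n h. P x n h}" by blast
    next
      fix c x assume "x \<in> {x. \<exists>n h. P x n h}"
      then obtain n h where "P x n h" by blast
      then have "P (s c x) n (\<lambda>k. s c (h k))"
        using assms(2) by (simp add: P_def subspace_scale scale_sum_right)
      then show "s c x \<in> {x. \<exists>n h. P x n h}" by blast
    qed
  qed
  then show ?thesis using assms(3) unfolding P_def by blast
qed

lemma weight_grading_singleton:
  assumes F: "vertex_algebra F" and G: "weight_grading {a} F \<iota> G"
  shows "module.subspace (vscale F) (G (replicate_mset k a))"
    and "G (replicate_mset k a) \<subseteq> vcarrier F"
    and "vvac F \<in> G (replicate_mset 0 a)" "\<iota> a \<in> G (replicate_mset 1 a)"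
    and "\<lbrakk>x \<in> G (replicate_mset k a); y \<in> G (replicate_mset l a)\<rbrakk> \<Longrightarrow>
      vprod F x n y \<in> G (replicate_mset (k + l) a)"
    and "\<lbrakk>\<And>l. l < m \<Longrightarrow> h l \<in> G (replicate_mset l a); (\<Sum>l<m. h l) = 0; k < m\<rbrakk> \<Longrightarrow> h k = 0"
proof -
  interpret vector_space "vscale F" by (rule va_unfold[OF F])
  note g = G[unfolded weight_grading_def]
  have rep: "set_mset (replicate_mset k a) \<subseteq> {a}" for k by (auto split: if_splits)
  show "subspace (G (replicate_mset k a))" using g[THEN conjunct1] rep by blast
  have "vcarrier F = span (\<Union>l\<in>{l. set_mset l \<subseteq> {a}}. G l)"
    by (rule g[THEN conjunct2, THEN conjunct1])
  then show "G (replicate_mset k a) \<subseteq> vcarrier F"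
    using rep span_superset[of "\<Union>l\<in>{l. set_mset l \<subseteq> {a}}. G l"] by blast
  show "vvac F \<in> G (replicate_mset 0 a)" "\<iota> a \<in> G (replicate_mset 1 a)" using g by simp_all
  show "vprod F x n y \<in> G (replicate_mset (k + l) a)"
    if "x \<in> G (replicate_mset k a)" "y \<in> G (replicate_mset l a)"
  proof -
    have "replicate_mset (k + l) a = replicate_mset k a + replicate_mset l a" by (induction k) simp_all
    then show ?thesis
      using g[THEN conjunct2, THEN conjunct2, THEN conjunct2, THEN conjunct2, THEN conjunct2] rep that by simp
  qed
  show "h k = 0" if "\<And>l. l < m \<Longrightarrow> h l \<in> G (replicate_mset l a)" "(\<Sum>l<m. h l) = 0" "k < m"
  proof -
    let ?L = "(\<lambda>l. replicate_mset l a) ` {..<m}"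
    have "(\<Sum>M\<in>?L. h (size M)) = (\<Sum>l<m. h l)"
      by (subst sum.reindex) (auto simp: inj_on_def dest: arg_cong[where f = size])
    then have "(\<Sum>M\<in>?L. h (size M)) = 0" using that(2) by simp
    moreover have "\<forall>M\<in>?L. set_mset M \<subseteq> {a} \<and> h (size M) \<in> G M" using rep that(1) by auto
    moreover have "finite ?L" by simp
    ultimately have "\<forall>M\<in>?L. h (size M) = 0"
      by (intro g[THEN conjunct2, THEN conjunct2, THEN conjunct1, THEN spec, THEN spec, THEN mp] conjI)
    then show ?thesis using that(3) by auto
  qed
qed

text \<open>
  The span of all \<open>H\<^sub>k\<close> is a vertex subalgebra containing the generator, hence everything; independence
  of the weight components then forces each inclusion to be an equality.
\<close>

lemma singly_generated_grading_component:
  fixes F :: "('k::field_char_0, 'f::ab_group_add) valg"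
  assumes F: "vertex_algebra F" and gen: "va_generated_by F {\<iota> a}"
    and G: "weight_grading {a} F \<iota> G"
    and H: "\<And>k. module.subspace (vscale F) (H k)" "\<And>k. H k \<subseteq> G (replicate_mset k a)"
    and vac: "vvac F \<in> H 0" and gen_mem: "\<iota> a \<in> H 1"
    and prod: "\<And>k l x y n. x \<in> H k \<Longrightarrow> y \<in> H l \<Longrightarrow> vprod F x n y \<in> H (k + l)"
  shows "H k = G (replicate_mset k a)"
proof
  interpret vector_space "vscale F" by (rule va_unfold[OF F])
  note cs = vcarrier_subspace[OF F]
  define U where "U = span (\<Union>k. H k)"
  note Gcar = weight_grading_singleton(2)[OF F G]
  have Hcar: "H k \<subseteq> vcarrier F" for k using H(2) Gcar by blast
  have Ucar: "U \<subseteq> vcarrier F" unfolding U_def using Hcar by (intro span_minimal cs) auto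
  have HU: "H k \<subseteq> U" for k unfolding U_def using span_superset by blast
  have zero: "vprod F u n 0 = 0 \<and> vprod F 0 n u = 0" if "u \<in> vcarrier F" for u n
    using va_unfold(9)[OF F that that, of 0 n] va_unfold(10)[OF F that that, of n 0] by simp
  have subU: "subspace U" by (simp add: U_def)
  have R: "subspace {y \<in> vcarrier F. vprod F u n y \<in> U}" if "u \<in> vcarrier F" for u n
    by (rule subspaceI)
      (use that zero subU cs in \<open>auto simp: va_unfold[OF F] subspace_0 subspace_add subspace_scale\<close>)
  have L: "subspace {x \<in> vcarrier F. vprod F x n u \<in> U}" if "u \<in> vcarrier F" for u n
    by (rule subspaceI)
      (use that zero subU cs in \<open>auto simp: va_unfold[OF F] subspace_0 subspace_add subspace_scale\<close>)
  have R': "U \<subseteq> {y \<in> vcarrier F. vprod F x n y \<in> U}" if "x \<in> H k" for x n k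
    unfolding U_def by (rule span_minimal[OF _ R[unfolded U_def]])
      (use that Hcar prod HU[unfolded U_def] in blast)+
  have L': "U \<subseteq> {x \<in> vcarrier F. vprod F x n y \<in> U}" if "y \<in> U" for y n
  proof -
    have "vprod F x n y \<in> U" if "x \<in> H k" for x k using R'[OF that] \<open>y \<in> U\<close> by blast
    then have "(\<Union>k. H k) \<subseteq> {x \<in> vcarrier F. vprod F x n y \<in> U}" using Hcar by blast
    moreover have "y \<in> vcarrier F" using that Ucar by blast
    ultimately show ?thesis using span_minimal[OF _ L] U_def by blast
  qed
  have "U = vcarrier F"
    using gen Ucar subU HU[of 0] HU[of 1] vac gen_mem L' unfolding va_generated_by_def by blast
  show "H k \<subseteq> G (replicate_mset k a)" by (rule H)
  show "G (replicate_mset k a) \<subseteq> H k"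
  proof
    fix x assume x: "x \<in> G (replicate_mset k a)"
    then have "x \<in> span (\<Union>k. H k)" using Gcar \<open>U = vcarrier F\<close> U_def by blast
    then obtain n h where h: "\<And>l. h l \<in> H l" "\<And>l. l \<ge> n \<Longrightarrow> h l = 0" "x = (\<Sum>l<n. h l)"
      using span_UN_subspaces[OF vector_space_axioms, of H x] H(1) by blast
    \<comment> \<open>The index \<open>k\<close> has to occur in the sum to be compared with \<open>x\<close>.\<close>
    define m where "m = max n (Suc k)"
    have km: "k < m" by (simp add: m_def)
    have xm: "x = (\<Sum>l<m. h l)"
      unfolding h(3) by (rule sum.mono_neutral_left) (auto simp: m_def h(2))
    define g where "g l = h l - (if l = k then x else 0)" for l
    have "g k = 0"
    proof (rule weight_grading_singleton(6)[OF F G])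
      show "g l \<in> G (replicate_mset l a)" if "l < m" for l
        unfolding g_def using h(1)[of l] H(2)[of l] x weight_grading_singleton(1)[OF F G]
        by (auto intro!: subspace_diff)
      show "(\<Sum>l<m. g l) = 0" "k < m"
        using km unfolding g_def by (simp_all add: sum_subtractf xm[symmetric])
    qed
    then show "x \<in> H k" using h(1)[of k] by (simp add: g_def)
  qed
qed

context lattice_vertex_algebra begin

lemma image_weight_component:
  fixes F :: "('k, 'f::ab_group_add) valg"
  assumes F: "vertex_algebra F" and gen: "va_generated_by F {\<iota> a}"
    and G: "weight_grading {a} F \<iota> G" and hom: "va_hom F V \<phi>" and a: "\<phi> (\<iota> a) = vtop 1"
  shows "\<phi> ` G (replicate_mset k a) = mon_span k"
proof
  interpret F: vector_space "vscale F" by (rule va_unfold[OF F])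
  define W where "W k = G (replicate_mset k a)" for k
  note subW = weight_grading_singleton(1)[OF F G, folded W_def]
    and Wcar = weight_grading_singleton(2)[OF F G, folded W_def]
    and vacW = weight_grading_singleton(3)[OF F G, folded W_def]
    and aW = weight_grading_singleton(4)[OF F G, folded W_def]
    and prodW = weight_grading_singleton(5)[OF F G, folded W_def]
  have hom_simps: "\<phi> (x + y) = \<phi> x + \<phi> y" "\<phi> (vscale F r x) = r *s \<phi> x"
    "\<phi> (vprod F x n y) = \<phi> x \<cdot>\<^bsub>n\<^esub> \<phi> y" if "x \<in> W k" "y \<in> W l" for x y r n k l
    using hom that Wcar unfolding va_hom_def by blast+
  have hom_vac: "\<phi> (vvac F) = vvac V" using hom by (simp add: va_hom_def)
  have hom0: "\<phi> 0 = 0"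
    using hom_simps(1)[of 0 0 0 0] F.subspace_0[OF subW] by simp

  define H where "H k = {x \<in> W k. \<phi> x \<in> mon_span k}" for k
  have "H k = G (replicate_mset k a)"
  proof (rule singly_generated_grading_component[OF F gen G])
    show "F.subspace (H k)" for k
      unfolding H_def using subW[of k] subspace_mon_span[of k]
      by (intro F.subspaceI) (auto simp: hom0 hom_simps F.subspace_0 F.subspace_add F.subspace_scale
          subspace_0 subspace_add subspace_scale)
    show "vvac F \<in> H 0" using mon_in_span[of "[]"] vacW by (simp add: H_def hom_vac)
    have "psi (-1) (vvac V) = vtop 1" using vac_right[of "vtop 1" 0] by simp
    then show "\<iota> a \<in> H 1" using mon_in_span[of "[-1]"] aW by (simp add: H_def a)
    show "vprod F x n y \<in> H (k + l)" if "x \<in> H k" "y \<in> H l" for k l x y n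
      using that mon_span_prod[of "\<phi> x" k "\<phi> y" l n] prodW by (auto simp: H_def hom_simps)
  qed (auto simp: H_def W_def)
  then show "\<phi> ` G (replicate_mset k a) \<subseteq> mon_span k" unfolding H_def by blast

  have "\<exists>x\<in>W (length ns). \<phi> x = mon ns" for ns
  proof (induction ns)
    case Nil
    then show ?case using vacW hom_vac by auto
  next
    case (Cons n ns)
    then obtain x where x: "x \<in> W (length ns)" "\<phi> x = mon ns" by blast
    have "vprod F (\<iota> a) n x \<in> W (length (n # ns))" using prodW[OF aW x(1)] by simp
    moreover have "\<phi> (vprod F (\<iota> a) n x) = mon (n # ns)" using hom_simps(3)[OF aW x(1)] x(2) a by simp
    ultimately show ?case by blast
  qed
  then have "mon ` {ns. length ns = k} \<subseteq> \<phi> ` W k" by (metis (mono_tags, lifting) image_eqI image_subsetI mem_Collect_eq)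
  moreover have "subspace (\<phi> ` W k)"
  proof (rule subspaceI)
    show "0 \<in> \<phi> ` W k" using hom0 F.subspace_0[OF subW] by (metis imageI)
    show "x + y \<in> \<phi> ` W k" if "x \<in> \<phi> ` W k" "y \<in> \<phi> ` W k" for x y
      using that F.subspace_add[OF subW] hom_simps(1) by (auto intro!: image_eqI simp flip: hom_simps(1))
    show "c *s x \<in> \<phi> ` W k" if "x \<in> \<phi> ` W k" for c x
      using that F.subspace_scale[OF subW] by (auto simp flip: hom_simps(2))
  qed
  ultimately show "mon_span k \<subseteq> \<phi> ` G (replicate_mset k a)"
    unfolding mon_span_def W_def by (intro span_minimal)
qed

end

theorem mainTheorem5:
  fixes F :: "('k::field_char_0, 'f::ab_group_add) valg"
    and V :: "('k, 'k fock) valg"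
    and a :: 'b and N :: "'b \<Rightarrow> 'b \<Rightarrow> int" and \<iota> :: "'b \<Rightarrow> 'f"
    and G :: "'b multiset \<Rightarrow> 'f set" and \<phi> :: "'f \<Rightarrow> 'k fock" and k :: nat
  assumes "N a a = -1"
    and "free_vertex_algebra {a} N F \<iota>"
    and "weight_grading {a} F \<iota> G"
    and "lattice_VZ V"
    and "va_hom F V \<phi>" and "\<phi> (\<iota> a) = vtop 1"
    and "k \<ge> 1"
  shows "\<phi> ` G (replicate_mset k a) = UW_submodule V (vtop k)"
proof -
  interpret lattice_vertex_algebra V
    using lattice_VZ_total[OF assms(4)] assms(4)
    by (simp add: lattice_vertex_algebra_def lattice_vertex_algebra_axioms_def)
  have "vertex_algebra F" "va_generated_by F {\<iota> a}"
    using assms(2) by (simp_all add: free_vertex_algebra_def)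
  then show ?thesis
    unfolding UW_submodule_eq_mon_span by (rule image_weight_component) (rule assms)+
qed

end
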